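(* Let $\theta\neq0$, $\mathbb{M}\in\mathbb{D}_{++}^{n}$, and let $C\ge1$ be the number of classes. For each class $k=1,\dots,C$ let $P_k\in\mathcal{S}^n_{++}$ and $A_k\in\mathcal{L}^n$ be parameters. Given an input SPD matrix $S\in\mathcal{S}^n_{++}$, the $C$-class SPD multinomial logistic regressions (Riemannian MLRs on $\mathcal{S}^n_{++}$, defined in the context) under the metrics $\theta$-PCM and $(\theta,\mathbb{M})$-BWCM are, respectively, $$\theta\text{-PCM}:\quad p(y=k\mid S)\propto\exp\left[\langle\lfloor K\rfloor-\lfloor L_k\rfloor,\lfloor A_k\rfloor\rangle+\frac{1}{2\theta}\langle\mathbb{K}^\theta-\mathbb{L}_k^\theta,\mathbb{A}_k\rangle\right],$$ $$(\theta,\mathbb{M})\text{-BWCM}:\quad p(y=k\mid S)\propto\exp\left[\langle\lfloor K\rfloor-\lfloor L_k\rfloor,\lfloor A_k\rfloor\rangle+\frac{1}{4\theta}\langle\mathbb{K}^{\theta/2}-\mathbb{L}_k^{\theta/2},\mathbb{M}^{-1}\mathbb{A}_k\rangle\right],$$ where $S=KK^\top$ and $P_k=L_kL_k^\top$ are Cholesky decompositions.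
   Context: $\mathcal{S}^n_{++}$ is the manifold of real $n\times n$ symmetric positive definite matrices; $\mathcal{L}^n$ is the space of lower triangular $n\times n$ matrices; $\mathcal{L}_{++}^{n}\subset\mathcal{L}^n$ is the open subset with positive diagonal entries; $\mathbb{D}_{++}^{n}$ is the set of $n\times n$ diagonal matrices with positive diagonal. For a square matrix $A$, $\lfloor A\rfloor$ is its strictly lower triangular part and the blackboard-bold letter $\mathbb{A}$ is the diagonal matrix with the diagonal entries of $A$ (so $\mathbb{K},\mathbb{L}_k,\mathbb{A}_k$ come from $K,L_k,A_k$). Powers of positive diagonal matrices are entrywise on the diagonal; $\langle\cdot,\cdot\rangle$ is the Frobenius inner product. $\operatorname{Chol}:\mathcal{S}^n_{++}\to\mathcal{L}_{++}^{n}$ is the Cholesky decomposition, a diffeomorphism with inverse $L\mapsto LL^\top$; its differential at $P=LL^\top$ is $V\mapsto L\left(L^{-1}VL^{-\top}\right)_{1/2}$ with $(V)_{1/2}=\lfloor V\rfloor+\frac12\mathbb{V}$. $\theta$-PCM (Power–Cholesky Metric) is the pullback by $\operatorname{Chol}$ of the metric $g_L(X,Y)=\langle\lfloor X\rfloor,\lfloor Y\rfloor\rangle+\langle\mathbb{L}^{\theta-1}\mathbb{X},\mathbb{L}^{\theta-1}\mathbb{Y}\rangle$ on $\mathcal{L}_{++}^{n}$. $(\theta,\mathbb{M})$-BWCM (Bures–Wasserstein–Cholesky Metric) is the pullback by $\operatorname{Chol}$ of $g_L(X,Y)=\langle\lfloor X\rfloor,\lfloor Y\rfloor\rangle+\frac14\langle\mathbb{L}^{\theta-2}\mathbb{X},\mathbb{M}^{-1}\mathbb{Y}\rangle$.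 Riemannian MLR. For a Riemannian metric on $\mathcal{M}=\mathcal{S}^n_{++}$ with Riemannian logarithm $\operatorname{Log}$, inner product $\langle\cdot,\cdot\rangle_P$ and norm $\|\cdot\|_P$ on $T_P\mathcal{M}$, points $P_k\in\mathcal{M}$ and tangent vectors $\tilde A_k\in T_{P_k}\mathcal{M}$, the $C$-class Riemannian MLR is $$p(y=k\mid S)\propto\exp\left(\operatorname{sign}\left(\langle\tilde A_k,\operatorname{Log}_{P_k}(S)\rangle_{P_k}\right)\|\tilde A_k\|_{P_k}\operatorname{d}(S,H_{\tilde A_k,P_k})\right),\qquad k=1,\dots,C,$$ where $\propto$ means equality up to normalization over $k$, $H_{\tilde A,P}=\{Q\in\mathcal{M}\mid\langle\operatorname{Log}_P(Q),\tilde A\rangle_P=0\}$, and $\operatorname{d}(S,H_{\tilde A,P})=|\langle\operatorname{Log}_P(S),\tilde A\rangle_P|/\|\tilde A\|_P$ is the Riemannian margin distance to the hyperplane (the exponent is read as $0$ when $\tilde A_k=0$). The tangent parameter $\tilde A_k$ is generated from the parameter $A_k\in\mathcal{L}^n$ by $\tilde A_k=\operatorname{PT}_{I\to P_k}(\hat A_k)$, where $\hat A_k\in T_I\mathcal{S}^n_{++}$ is the symmetric matrix whose lower triangular part (including the diagonal) is $A_k$, and $\operatorname{PT}_{I\to P_k}$ is the parallel transport along the geodesic from $I$ to $P_k$ for the given metric. *)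

theory Defs
  imports "HOL-Analysis.Analysis"
begin

text \<open>
  \<^bold>\<open>Riemannian geometry in one global linear chart.\<close>
  The manifold is a set \<open>U\<close> that is relatively open in a linear subspace \<open>E\<close> of a normed space, so
  every tangent space is \<open>E\<close>; a metric is a function \<open>g P X Y\<close> with \<open>P \<in> U\<close> and \<open>X, Y \<in> E\<close>.
\<close>

definition dir_deriv :: "('a::real_normed_vector \<Rightarrow> 'b::real_normed_vector) \<Rightarrow> 'a \<Rightarrow> 'a \<Rightarrow> 'b" where
  "dir_deriv f P X = vector_derivative (\<lambda>t. f (P + t *\<^sub>R X)) (at (0::real))"

definition pullback_metric ::
  "('a::real_normed_vector \<Rightarrow> 'b::real_normed_vector) \<Rightarrow> ('b \<Rightarrow> 'b \<Rightarrow> 'b \<Rightarrow> real) \<Rightarrow> 'a \<Rightarrow> 'a \<Rightarrow> 'a \<Rightarrow> real"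
where
  "pullback_metric f g P X Y = g (f P) (dir_deriv f P X) (dir_deriv f P Y)"

text \<open>
  Levi-Civita connection: the Christoffel symbol as a vector of \<open>E\<close>, given by Koszul's formula for the
  constant (hence commuting) fields \<open>X\<close>, \<open>Y\<close>, \<open>Z\<close>.  Quantifying \<open>Z\<close> over \<open>E\<close> only is essential,
  as \<open>g\<close> has no meaning outside of \<open>E\<close>.
\<close>

definition christoffel ::
  "'a::real_normed_vector set \<Rightarrow> ('a \<Rightarrow> 'a \<Rightarrow> 'a \<Rightarrow> real) \<Rightarrow> 'a \<Rightarrow> 'a \<Rightarrow> 'a \<Rightarrow> 'a" where
  "christoffel E g P X Y = (THE W. W \<in> E \<and> (\<forall>Z\<in>E.
     2 * g P W Z = dir_deriv (\<lambda>Q. g Q Y Z) P X + dir_deriv (\<lambda>Q. g Q X Z) P Y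
                   - dir_deriv (\<lambda>Q. g Q X Y) P Z))"

definition velocity :: "(real \<Rightarrow> 'a::real_normed_vector) \<Rightarrow> real \<Rightarrow> 'a" where
  "velocity c t = vector_derivative c (at t within {0..1})"

definition parallel_along ::
  "'a::real_normed_vector set \<Rightarrow> ('a \<Rightarrow> 'a \<Rightarrow> 'a \<Rightarrow> real) \<Rightarrow> (real \<Rightarrow> 'a) \<Rightarrow> (real \<Rightarrow> 'a) \<Rightarrow> bool" where
  "parallel_along E g c V \<longleftrightarrow> (\<forall>t\<in>{0..1}. V t \<in> E \<and>
     (V has_vector_derivative - christoffel E g (c t) (velocity c t) (V t)) (at t within {0..1}))"

definition geodesic ::
  "'a::real_normed_vector set \<Rightarrow> 'a set \<Rightarrow> ('a \<Rightarrow> 'a \<Rightarrow> 'a \<Rightarrow> real) \<Rightarrow> (real \<Rightarrow> 'a) \<Rightarrow> bool" where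
  "geodesic E U g c \<longleftrightarrow> (\<forall>t\<in>{0..1}. c t \<in> U \<and> c differentiable (at t within {0..1}))
     \<and> parallel_along E g c (velocity c)"

definition riem_log ::
  "'a::real_normed_vector set \<Rightarrow> 'a set \<Rightarrow> ('a \<Rightarrow> 'a \<Rightarrow> 'a \<Rightarrow> real) \<Rightarrow> 'a \<Rightarrow> 'a \<Rightarrow> 'a" where
  "riem_log E U g P Q =
     (THE v. \<exists>c. geodesic E U g c \<and> c 0 = P \<and> c 1 = Q \<and> velocity c 0 = v)"

definition par_transport ::
  "'a::real_normed_vector set \<Rightarrow> 'a set \<Rightarrow> ('a \<Rightarrow> 'a \<Rightarrow> 'a \<Rightarrow> real) \<Rightarrow> 'a \<Rightarrow> 'a \<Rightarrow> 'a \<Rightarrow> 'a" where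
  "par_transport E U g P Q X =
     (THE w. \<exists>c V. geodesic E U g c \<and> c 0 = P \<and> c 1 = Q \<and> parallel_along E g c V \<and> V 0 = X \<and> V 1 = w)"

definition riem_norm :: "('a \<Rightarrow> 'a \<Rightarrow> 'a \<Rightarrow> real) \<Rightarrow> 'a \<Rightarrow> 'a \<Rightarrow> real" where
  "riem_norm g P X = sqrt (g P X X)"

text \<open>
  Riemannian margin distance from \<open>S\<close> to the hyperplane \<open>{Q \<in> U. g P (riem_log E U g P Q) A = 0}\<close>.
\<close>

definition margin_dist ::
  "'a::real_normed_vector set \<Rightarrow> 'a set \<Rightarrow> ('a \<Rightarrow> 'a \<Rightarrow> 'a \<Rightarrow> real) \<Rightarrow> 'a \<Rightarrow> 'a \<Rightarrow> 'a \<Rightarrow> real" where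
  "margin_dist E U g A P S = \<bar>g P (riem_log E U g P S) A\<bar> / riem_norm g P A"

text \<open>The function proportional to \<open>exp (s k)\<close> that sums to one over the classes \<open>1, \<dots>, C\<close>.\<close>

definition softmax :: "nat \<Rightarrow> (nat \<Rightarrow> real) \<Rightarrow> nat \<Rightarrow> real" where
  "softmax C s k = exp (s k) / (\<Sum>j=1..C. exp (s j))"

text \<open>For \<open>At k = 0\<close> the exponent is \<open>0\<close>, since \<open>sgn 0 = 0\<close> and \<open>x / 0 = 0\<close>.\<close>

definition riem_mlr ::
  "'a::real_normed_vector set \<Rightarrow> 'a set \<Rightarrow> ('a \<Rightarrow> 'a \<Rightarrow> 'a \<Rightarrow> real) \<Rightarrow> nat \<Rightarrow>
   (nat \<Rightarrow> 'a) \<Rightarrow> (nat \<Rightarrow> 'a) \<Rightarrow> 'a \<Rightarrow> nat \<Rightarrow> real" where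
  "riem_mlr E U g C P At S = softmax C (\<lambda>k.
     sgn (g (P k) (At k) (riem_log E U g (P k) S)) * riem_norm g (P k) (At k)
       * margin_dist E U g (At k) (P k) S)"

text \<open>
  \<^bold>\<open>Matrices.\<close>  The index type carries a linear order, which gives triangularity its meaning.
  The inner product \<open>A \<bullet> B\<close> of \<^typ>\<open>real^'n^'n\<close> is the Frobenius inner product.
\<close>

type_synonym 'n sqmat = "real^'n^'n"

definition sym_mats :: "('n::finite sqmat) set" where
  "sym_mats = {A. transpose A = A}"

definition spd :: "('n::finite sqmat) set" where
  "spd = {A. transpose A = A \<and> (\<forall>x. x \<noteq> 0 \<longrightarrow> 0 < x \<bullet> (A *v x))}"

definition lower :: "('n::{finite,linorder} sqmat) set" where
  "lower = {A. \<forall>i j. i < j \<longrightarrow> A $ i $ j = 0}"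

definition lower_pp :: "('n::{finite,linorder} sqmat) set" where
  "lower_pp = {A \<in> lower. \<forall>i. 0 < A $ i $ i}"

definition diag_pp :: "('n::finite sqmat) set" where
  "diag_pp = {A. (\<forall>i j. i \<noteq> j \<longrightarrow> A $ i $ j = 0) \<and> (\<forall>i. 0 < A $ i $ i)}"

definition slow :: "'n::{finite,linorder} sqmat \<Rightarrow> 'n sqmat" where
  "slow A = (\<chi> i j. if j < i then A $ i $ j else 0)"

definition dg :: "'n::finite sqmat \<Rightarrow> 'n sqmat" where
  "dg A = (\<chi> i j. if i = j then A $ i $ j else 0)"

text \<open>Power of a positive diagonal matrix; off the diagonal the result is \<open>0\<close> for every exponent.\<close>

definition dpow :: "'n::finite sqmat \<Rightarrow> real \<Rightarrow> 'n sqmat" where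
  "dpow D a = (\<chi> i j. if i = j then (D $ i $ i) powr a else 0)"

definition sym_of_lower :: "'n::{finite,linorder} sqmat \<Rightarrow> 'n sqmat" where
  "sym_of_lower A = (\<chi> i j. if j \<le> i then A $ i $ j else A $ j $ i)"

definition chol :: "'n::{finite,linorder} sqmat \<Rightarrow> 'n sqmat" where
  "chol P = (THE L. L \<in> lower_pp \<and> L ** transpose L = P)"

definition pcm_chol ::
  "real \<Rightarrow> 'n::{finite,linorder} sqmat \<Rightarrow> 'n sqmat \<Rightarrow> 'n sqmat \<Rightarrow> real" where
  "pcm_chol \<theta> L X Y = slow X \<bullet> slow Y
     + (dpow (dg L) (\<theta> - 1) ** dg X) \<bullet> (dpow (dg L) (\<theta> - 1) ** dg Y)"

definition bwcm_chol ::
  "real \<Rightarrow> 'n sqmat \<Rightarrow> 'n::{finite,linorder} sqmat \<Rightarrow> 'n sqmat \<Rightarrow> 'n sqmat \<Rightarrow> real" where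
  "bwcm_chol \<theta> M L X Y = slow X \<bullet> slow Y
     + 1/4 * ((dpow (dg L) (\<theta> - 2) ** dg X) \<bullet> (matrix_inv M ** dg Y))"

definition pcm :: "real \<Rightarrow> 'n::{finite,linorder} sqmat \<Rightarrow> 'n sqmat \<Rightarrow> 'n sqmat \<Rightarrow> real" where
  "pcm \<theta> = pullback_metric chol (pcm_chol \<theta>)"

definition bwcm ::
  "real \<Rightarrow> 'n sqmat \<Rightarrow> 'n::{finite,linorder} sqmat \<Rightarrow> 'n sqmat \<Rightarrow> 'n sqmat \<Rightarrow> real" where
  "bwcm \<theta> M = pullback_metric chol (bwcm_chol \<theta> M)"

definition spd_mlr ::
  "('n::{finite,linorder} sqmat \<Rightarrow> 'n sqmat \<Rightarrow> 'n sqmat \<Rightarrow> real) \<Rightarrow> nat \<Rightarrow>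
   (nat \<Rightarrow> 'n sqmat) \<Rightarrow> (nat \<Rightarrow> 'n sqmat) \<Rightarrow> 'n sqmat \<Rightarrow> nat \<Rightarrow> real" where
  "spd_mlr g C P A = riem_mlr sym_mats spd g C P
     (\<lambda>k. par_transport sym_mats spd g (mat 1) (P k) (sym_of_lower (A k)))"

end

theory Submission
  imports Defs
begin

text \<open>
  Both metrics are flat. Let \<open>r = 1 / \<theta>\<close> for the Power--Cholesky metric and \<open>r = 2 / \<theta>\<close> for the
  Bures--Wasserstein--Cholesky metric, and let \<open>\<psi>\<close> raise the diagonal of a lower triangular matrix
  to the power \<open>r\<close>. In the coordinates \<open>Y \<mapsto> \<psi> Y (\<psi> Y)\<^sup>T\<close>, with \<open>Y\<close> in the convex cone
  \<open>lower_pp\<close>, the metric is a constant bilinear form. So geodesics are images of segments, parallel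
  fields have constant coordinates, and the score of a class is the form evaluated at the difference
  of the coordinates of \<open>S\<close> and \<open>P k\<close> and at the coordinates of the symmetric matrix of \<open>A k\<close> at
  the identity. The coordinate map is polynomial up to powers of the diagonal; the regularity of its
  inverse, the Cholesky decomposition, comes from invariance of domain.
\<close>

section \<open>Charts between linear subspaces\<close>

text \<open>Since the dimensions agree, invariance of domain makes \<open>f\<close> send relatively
  open subsets of \<open>S\<close> to relatively open subsets of \<open>B\<close>. Openness of this
  map is exactly continuity of its inverse.\<close>

lemma inverse_continuous_subspace:
  fixes f :: "'a::euclidean_space \<Rightarrow> 'b::euclidean_space"
  assumes "subspace A" "subspace B" "dim A = dim B" "openin (top_of_set A) S"
    and f: "continuous_on S f" "f \<in> S \<rightarrow> B" and gf: "\<And>x. x \<in> S \<Longrightarrow> g (f x) = x"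
  shows "openin (top_of_set B) (f ` S)" "continuous_on (f ` S) g"
proof -
  have inj: "inj_on f S"
    by (metis gf inj_on_inverseI)
  have im: "openin (top_of_set B) (f ` O')" if "openin (top_of_set A) O'" "O' \<subseteq> S" for O'
    by (rule invariance_of_domain_subspaces[OF that(1) assms(1,2)])
       (use assms that in \<open>auto intro: continuous_on_subset inj_on_subset[OF inj]\<close>)
  then show "openin (top_of_set B) (f ` S)"
    using assms by blast
  show "continuous_on (f ` S) g"
  proof (rule continuous_on_inverse_open_map[OF f(1) refl gf])
    fix O' assume O': "openin (top_of_set S) O'"
    then have "O' \<subseteq> S" "openin (top_of_set A) O'"
      using assms(4) openin_trans openin_imp_subset by blast+
    then show "openin (top_of_set (f ` S)) (f ` O')"
      using im f(2) by (metis PiE image_mono image_subsetI openin_subset_trans)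
  qed
qed

text \<open>The previous lemma gives continuity of \<open>g\<close>, so points \<open>f u\<close>
  near \<open>f x\<close> come from \<open>u\<close> near \<open>x\<close>, where \<open>f\<close>
  is almost linear. Differences \<open>u - x\<close> lie in \<open>A\<close>, which is why a left
  inverse of \<open>f' x\<close> on \<open>A\<close> is enough.\<close>

lemma has_derivative_inverse_within_subspace:
  fixes f :: "'a::euclidean_space \<Rightarrow> 'b::euclidean_space"
  assumes A: "subspace A" and B: "subspace B" "dim A = dim B" and S: "openin (top_of_set A) S"
    and f: "\<And>x. x \<in> S \<Longrightarrow> (f has_derivative f' x) (at x within S)" "f \<in> S \<rightarrow> B"
    and gf: "\<And>x. x \<in> S \<Longrightarrow> g (f x) = x"
    and x: "x \<in> S" and g': "bounded_linear g'" and g'f': "\<And>k. k \<in> A \<Longrightarrow> g' (f' x k) = k"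
  shows "(g has_derivative g') (at (f x) within f ` S)"
proof -
  have contf: "continuous_on S f"
    using f(1) has_derivative_continuous_on by blast
  have contg: "continuous_on (f ` S) g"
    by (rule inverse_continuous_subspace[OF A B S contf f(2) gf])
  interpret g': bounded_linear g' by fact
  obtain K where K: "K > 0" "\<And>v. norm (g' v) \<le> norm v * K"
    using g'.pos_bounded by blast
  have "\<forall>\<^sub>F z in at (f x) within f ` S. norm (g z - g (f x) - g' (z - f x)) \<le> e * norm (z - f x)"
    if "e > 0" for e
  proof -
    \<comment> \<open>The bound \<open>1 / (2 * K)\<close> lets half of \<open>norm (u - x)\<close>
      absorb the linearisation error, which yields the Lipschitz estimate with constant
      \<open>2 * K\<close>; the bound \<open>e / (2 * K^2)\<close> then brings the total error
      \<open>K * e0 * (2 * K)\<close> below \<open>e\<close>.\<close>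
    define e0 where "e0 = min (e / (2 * K^2)) (1 / (2 * K))"
    have e0: "e0 > 0" "K * e0 \<le> 1/2" "K * e0 * (2 * K) \<le> e"
      using K that by (auto simp: e0_def min_def field_simps power2_eq_square)
    have "\<forall>\<^sub>F u in at x within S. norm (f u - f x - f' x (u - x)) \<le> e0 * norm (u - x)"
      using f(1)[OF x] e0(1) unfolding has_derivative_within_alt2 by blast
    then obtain d where d: "d > 0"
      "\<And>u. u \<in> S \<Longrightarrow> u \<noteq> x \<Longrightarrow> dist u x < d \<Longrightarrow> norm (f u - f x - f' x (u - x)) \<le> e0 * norm (u - x)"
      unfolding eventually_at by blast
    have "\<forall>\<^sub>F z in at (f x) within f ` S. dist (g z) (g (f x)) < d"
      using contg x d(1) unfolding continuous_on tendsto_iff by blast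
    moreover have "\<forall>\<^sub>F z in at (f x) within f ` S. z \<in> f ` S"
      by (simp add: eventually_at_filter)
    ultimately show ?thesis
    proof eventually_elim
      case (elim z)
      then obtain u where u: "u \<in> S" "z = f u" by blast
      have "u \<noteq> x \<longrightarrow> norm (f u - f x - f' x (u - x)) \<le> e0 * norm (u - x)"
        using d(2) u elim gf x by auto
      moreover have "linear (f' x)"
        using f(1)[OF x] has_derivative_linear by blast
      ultimately have 1: "norm (f u - f x - f' x (u - x)) \<le> e0 * norm (u - x)"
        by (auto simp: linear_0)
      have "u - x \<in> A"
        using A S u x by (meson openin_imp_subset subspace_diff subsetD)
      then have "g' (f u - f x) - (u - x) = g' (f u - f x - f' x (u - x))"
        by (simp add: g'.diff g'f')
      then have "norm (g' (f u - f x) - (u - x)) \<le> norm (f u - f x - f' x (u - x)) * K"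
        using K by metis
      also have "\<dots> \<le> e0 * norm (u - x) * K"
        using 1 K by simp
      finally have 2: "norm (g' (f u - f x) - (u - x)) \<le> K * e0 * norm (u - x)"
        by (simp add: ac_simps)
      have "norm (u - x) \<le> norm (g' (f u - f x)) + norm (g' (f u - f x) - (u - x))"
        by (metis norm_minus_commute norm_triangle_sub)
      also have "\<dots> \<le> norm (f u - f x) * K + 1/2 * norm (u - x)"
        using 2 K(2) e0(2) by (smt (verit) mult_right_mono norm_ge_zero)
      finally have 3: "norm (u - x) \<le> 2 * K * norm (f u - f x)" by (simp add: algebra_simps)
      have "norm (g z - g (f x) - g' (z - f x)) = norm (g' (f u - f x) - (u - x))"
        using u x gf by (simp add: norm_minus_commute)
      also have "\<dots> \<le> K * e0 * (2 * K * norm (f u - f x))"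
        using 2 3 K e0 by (smt (verit) mult_left_mono mult_pos_pos)
      also have "\<dots> \<le> e * norm (f u - f x)"
        using e0(3) by (metis mult.assoc mult_right_mono norm_ge_zero)
      finally show ?case using u by simp
    qed
  qed
  then show ?thesis
    unfolding has_derivative_within_alt2 using g' by blast
qed

text \<open>A trivial kernel on \<open>A\<close> and equal dimensions force \<open>f\<close> to map
  \<open>A\<close> onto \<open>B\<close>, so any linear left inverse on \<open>A\<close> is also a
  right inverse on \<open>B\<close>. It is defined on the whole space because
  \<open>has_derivative\<close> asks for a global bounded linear map.\<close>

lemma left_inverse_on_subspace:
  fixes f :: "'a::euclidean_space \<Rightarrow> 'b::euclidean_space"
  assumes f: "linear f" "f \<in> A \<rightarrow> B" and AB: "subspace A" "subspace B" "dim A = dim B"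
    and ker: "\<And>k. k \<in> A \<Longrightarrow> f k = 0 \<Longrightarrow> k = 0"
  obtains g where "bounded_linear g" "\<And>x. g x \<in> A" "\<And>k. k \<in> A \<Longrightarrow> g (f k) = k"
    "\<And>x. x \<in> B \<Longrightarrow> f (g x) = x"
proof -
  have inj: "inj_on f A"
    using ker linear_injective_on_subspace_0[OF f(1) AB(1)] by blast
  obtain g where g: "g ` UNIV \<subseteq> A" "linear g" "\<forall>v\<in>A. g (f v) = v"
    using linear_exists_left_inverse_on[OF f(1) AB(1) inj] by blast
  have "f ` A = B"
  proof (rule subspace_dim_equal)
    show "subspace (f ` A)"
      using f AB by (simp add: linear_subspace_image)
    show "dim (f ` A) \<ge> dim B"
      using AB inj dim_image_eq[OF f(1), of A] span_eq_iff[of A] by (metis order_refl)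
  qed (use f AB in auto)
  then show ?thesis
    using that g linear_conv_bounded_linear by (metis imageE rangeI subsetD)
qed

text \<open>\<open>G\<close> parametrises the manifold by \<open>W\<close>, \<open>T y\<close> is
  its differential and \<open>T2 y k h\<close> the derivative of \<open>T y h\<close> as
  \<open>y\<close> moves in direction \<open>k\<close>. \<open>T_deriv\<close> is joint in base
  point and vector because both vary along a curve; \<open>T2_sym\<close> is the symmetry of second
  derivatives and makes the connection torsion free.\<close>

locale subspace_chart =
  fixes E :: "'a::euclidean_space set" and E' :: "'b::euclidean_space set" and W :: "'b set"
    and G :: "'b \<Rightarrow> 'a" and T :: "'b \<Rightarrow> 'b \<Rightarrow> 'a" and T2 :: "'b \<Rightarrow> 'b \<Rightarrow> 'b \<Rightarrow> 'a"
  assumes E: "subspace E" and E': "subspace E'" and dim_eq: "dim E' = dim E"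
    and W: "openin (top_of_set E') W" and inj_G: "inj_on G W"
    and G_in: "\<And>y. y \<in> W \<Longrightarrow> G y \<in> E"
    and G_deriv: "\<And>y. y \<in> W \<Longrightarrow> (G has_derivative T y) (at y within W)"
    and T_in: "\<And>y k. y \<in> W \<Longrightarrow> k \<in> E' \<Longrightarrow> T y k \<in> E"
    and T_ker: "\<And>y k. y \<in> W \<Longrightarrow> k \<in> E' \<Longrightarrow> T y k = 0 \<Longrightarrow> k = 0"
    and T_deriv: "\<And>y h. y \<in> W \<Longrightarrow> h \<in> E' \<Longrightarrow>
      ((\<lambda>p. T (fst p) (snd p)) has_derivative (\<lambda>q. T2 y (fst q) h + T y (snd q))) (at (y, h) within W \<times> E')"
    and T2_in: "\<And>y k h. y \<in> W \<Longrightarrow> k \<in> E' \<Longrightarrow> h \<in> E' \<Longrightarrow> T2 y k h \<in> E"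
    and T2_sym: "\<And>y k h. y \<in> W \<Longrightarrow> k \<in> E' \<Longrightarrow> h \<in> E' \<Longrightarrow> T2 y k h = T2 y h k"
begin

definition U where "U = G ` W"

definition F where "F = inv_into W G"

text \<open>The inverse of \<open>T y\<close> between \<open>E\<close> and \<open>E'\<close>,
  extended to a bounded linear map of the whole space; it reads off the coordinates of a tangent
  vector.\<close>

definition D where "D y = (SOME d. bounded_linear d \<and> (\<forall>x. d x \<in> E') \<and> (\<forall>k\<in>E'. d (T y k) = k) \<and>
  (\<forall>x\<in>E. T y (d x) = x))"

lemma W_subset: "W \<subseteq> E'"
  using W openin_imp_subset by blast

lemma F_G [simp]: "y \<in> W \<Longrightarrow> F (G y) = y"
  by (simp add: F_def inj_G)

lemma U_cases: assumes "P \<in> U" obtains y where "y \<in> W" "P = G y"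
  using assms by (auto simp: U_def)

lemma G_in_U [simp]: "y \<in> W \<Longrightarrow> G y \<in> U"
  by (simp add: U_def)

lemma T_linear: "y \<in> W \<Longrightarrow> linear (T y)"
  using G_deriv has_derivative_linear by blast

lemma D_props:
  assumes "y \<in> W"
  shows D_bl: "bounded_linear (D y)" and D_in: "D y x \<in> E'" and D_T: "k \<in> E' \<Longrightarrow> D y (T y k) = k"
    and T_D: "x \<in> E \<Longrightarrow> T y (D y x) = x"
proof -
  have "\<exists>d. bounded_linear d \<and> (\<forall>x. d x \<in> E') \<and> (\<forall>k\<in>E'. d (T y k) = k) \<and> (\<forall>x\<in>E. T y (d x) = x)"
    using left_inverse_on_subspace[OF T_linear[OF assms] _ E' E dim_eq]
    by (metis Pi_I T_in T_ker assms)
  from someI_ex[OF this, folded D_def]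
  show "bounded_linear (D y)" and "D y x \<in> E'" and "k \<in> E' \<Longrightarrow> D y (T y k) = k"
    and "x \<in> E \<Longrightarrow> T y (D y x) = x"
    by blast+
qed

lemma E_cases: assumes "y \<in> W" "x \<in> E" obtains k where "k \<in> E'" "x = T y k"
  using assms D_in T_D by metis

lemma U_open: "openin (top_of_set E) U"
  unfolding U_def
  by (rule inverse_continuous_subspace[OF E' E dim_eq W])
     (auto intro: F_G has_derivative_continuous_on G_deriv G_in)

lemma F_deriv:
  assumes "y \<in> W" shows "(F has_derivative D y) (at (G y) within U)"
  unfolding U_def
  by (rule has_derivative_inverse_within_subspace[OF E' E dim_eq W])
     (use assms in \<open>auto intro: G_deriv G_in D_bl D_T\<close>)

text \<open>This is the derivative of the inverse of the tangent map \<open>(y, h) \<mapsto> (G y, T y h)\<close>.\<close>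

lemma D_deriv:
  assumes y: "y \<in> W" and h: "h \<in> E'"
  shows "((\<lambda>p. D (F (fst p)) (snd p)) has_derivative
    (\<lambda>q. D y (snd q - T2 y (D y (fst q)) h))) (at (G y, T y h) within U \<times> E)"
proof -
  define TG where "TG = (\<lambda>p. (G (fst p), T (fst p) (snd p)))"
  define TG' where "TG' = (\<lambda>p q. (T (fst p) (fst q), T2 (fst p) (fst q) (snd p) + T (fst p) (snd q)))"
  define TF where "TF = (\<lambda>p. (F (fst p), D (F (fst p)) (snd p)))"
  \<comment> \<open>Found by solving \<open>TG' (y, h) (k, l) = q\<close>: the first component gives
    \<open>k = D y (fst q)\<close>, and the second then determines \<open>l\<close>.\<close>
  define TF' where "TF' = (\<lambda>q. (D y (fst q), D y (snd q - T2 y (D y (fst q)) h)))"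
  have UE: "U \<times> E = TG ` (W \<times> E')"
  proof (intro equalityI subrelI)
    fix P X assume "(P, X) \<in> U \<times> E"
    then obtain a k where "a \<in> W" "P = G a" "k \<in> E'" "X = T a k"
      by (auto elim!: U_cases) (metis E_cases)
    then show "(P, X) \<in> TG ` (W \<times> E')"
      by (intro image_eqI[of _ _ "(a, k)"]) (auto simp: TG_def)
  qed (auto simp: TG_def T_in)
  have TG_deriv: "(TG has_derivative TG' p) (at p within W \<times> E')" if p: "p \<in> W \<times> E'" for p
  proof -
    obtain a b where ab: "p = (a, b)" "a \<in> W" "b \<in> E'" using p by auto
    have "((\<lambda>p. G (fst p)) has_derivative (\<lambda>q. T (fst p) (fst q))) (at p within W \<times> E')"
      by (rule has_derivative_in_compose2[where t=W and g'=T])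
         (use ab G_deriv in \<open>auto intro!: derivative_eq_intros\<close>)
    then show ?thesis
      unfolding TG_def TG'_def using T_deriv[OF ab(2,3)] ab by (auto intro!: has_derivative_Pair)
  qed
  \<comment> \<open>Linearity in the direction is read off from the derivative in
    \<open>T_deriv\<close>, restricted to pairs \<open>(k, 0)\<close>.\<close>
  have T2_lin: "bounded_linear (\<lambda>k. T2 y k h)"
  proof -
    interpret bl: bounded_linear "\<lambda>q. T2 y (fst q) h + T y (snd q)"
      using T_deriv[OF y h] has_derivative_bounded_linear by blast
    have "bounded_linear (\<lambda>k::'b. T2 y (fst (k, 0::'b)) h + T y (snd (k, 0::'b)))"
      by (rule bounded_linear_compose[OF bl.bounded_linear_axioms, of "\<lambda>k. (k, 0)"])
        (auto intro!: bounded_linear_intros)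
    then show ?thesis
      using linear_0[OF T_linear[OF y]] by simp
  qed
  have "(TF has_derivative TF') (at (TG (y, h)) within TG ` (W \<times> E'))"
  proof (rule has_derivative_inverse_within_subspace[OF _ _ _ _ TG_deriv])
    show "subspace (E' \<times> E')" "subspace (E \<times> E)"
      using E E' by (auto simp: subspace_Times)
    show "dim (E' \<times> E') = dim (E \<times> E)"
      using E E' by (simp add: dim_Times dim_eq)
    show "openin (top_of_set (E' \<times> E')) (W \<times> E')"
      by (simp add: W openin_Times)
    show "TG \<in> W \<times> E' \<rightarrow> E \<times> E"
      by (auto simp: TG_def T_in G_in)
    show "TF (TG p) = p" if "p \<in> W \<times> E'" for p
      using that by (auto simp: TF_def TG_def D_T)
    show "(y, h) \<in> W \<times> E'" using y h by simp
    have "bounded_linear (\<lambda>q. T2 y (D y (fst q)) h)"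
      by (rule bounded_linear_compose[OF T2_lin])
         (intro bounded_linear_compose[OF D_bl[OF y]] bounded_linear_fst)
    then show "bounded_linear TF'"
      unfolding TF'_def
      by (intro bounded_linear_Pair bounded_linear_compose[OF D_bl[OF y]] bounded_linear_fst
          bounded_linear_sub bounded_linear_snd)
    show "TF' (TG' (y, h) k) = k" if "k \<in> E' \<times> E'" for k
      using that y h by (auto simp: TF'_def TG'_def D_T)
  qed
  then have "((\<lambda>p. snd (TF p)) has_derivative (\<lambda>q. snd (TF' q))) (at (TG (y, h)) within TG ` (W \<times> E'))"
    by (intro derivative_intros)
  then show ?thesis
    unfolding UE by (simp add: TF_def TF'_def TG_def)
qed

text \<open>\<open>dir_deriv\<close> differentiates along a straight line of the ambient space.
  Relative openness of \<open>U\<close> in \<open>E\<close> keeps a piece of this line inside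
  \<open>U\<close>, so chart formulas hold for all \<open>t\<close> near \<open>0\<close>.\<close>

lemma line_in_U:
  assumes y: "y \<in> W" and X: "X \<in> E"
  obtains N :: "real set" where "open N" "0 \<in> N" "\<And>t. t \<in> N \<Longrightarrow> G y + t *\<^sub>R X \<in> U"
proof -
  obtain O' where O': "open O'" "U = E \<inter> O'"
    using U_open unfolding openin_open by blast
  have "continuous_on UNIV (\<lambda>t::real. G y + t *\<^sub>R X)"
    by (intro continuous_intros)
  then have "open ((\<lambda>t. G y + t *\<^sub>R X) -` O')"
    using O' by (intro open_vimage)
  moreover have "0 \<in> (\<lambda>t. G y + t *\<^sub>R X) -` O'"
    using O' G_in_U[OF y] by auto
  moreover have "G y + t *\<^sub>R X \<in> U" if "t \<in> (\<lambda>t. G y + t *\<^sub>R X) -` O'" for t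
    using that O' G_in X y E by (simp add: subspace_add subspace_scale)
  ultimately show ?thesis using that by blast
qed

text \<open>On the line through \<open>G y\<close>, \<open>f\<close> is \<open>\<phi>\<close>
  composed with \<open>F\<close>, and the differential of \<open>F\<close> undoes
  \<open>T y\<close>; the chain rule does the rest.\<close>

lemma dir_deriv_chart:
  assumes f: "\<And>z. z \<in> W \<Longrightarrow> f (G z) = \<phi> z" and y: "y \<in> W" and k: "k \<in> E'"
    and \<phi>: "(\<phi> has_derivative \<phi>') (at y within W)"
  shows "dir_deriv f (G y) (T y k) = \<phi>' k"
proof -
  obtain N :: "real set" where N: "open N" "0 \<in> N" "\<And>t. t \<in> N \<Longrightarrow> G y + t *\<^sub>R T y k \<in> U"
    using line_in_U[OF y T_in[OF y k]] by blast
  let ?p = "\<lambda>t. G y + t *\<^sub>R T y k"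
  have "(?p has_vector_derivative T y k) (at 0 within N)"
    by (auto intro!: derivative_eq_intros)
  moreover have "(F has_derivative D y) (at (?p 0) within ?p ` N)"
    by (rule has_derivative_subset[of _ _ _ U]) (use F_deriv[OF y] N in auto)
  ultimately have "(F \<circ> ?p has_vector_derivative D y (T y k)) (at 0 within N)"
    by (rule vector_derivative_diff_chain_within)
  moreover have "(\<phi> has_derivative \<phi>') (at ((F \<circ> ?p) 0) within (F \<circ> ?p) ` N)"
    by (rule has_derivative_subset[of _ _ _ W]) (use \<phi> y N in \<open>auto elim!: U_cases[OF N(3)]\<close>)
  ultimately have "(\<phi> \<circ> (F \<circ> ?p) has_vector_derivative \<phi>' (D y (T y k))) (at 0 within N)"
    by (rule vector_derivative_diff_chain_within)
  then have "((\<lambda>t. f (?p t)) has_vector_derivative \<phi>' k) (at 0 within N)"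
    unfolding D_T[OF y k]
  proof (rule has_vector_derivative_transform[rotated 2])
    show "f (?p t) = (\<phi> \<circ> (F \<circ> ?p)) t" if "t \<in> N" for t
      using N(3)[OF that] f by (auto elim!: U_cases)
  qed (use N in auto)
  then show ?thesis
    unfolding dir_deriv_def at_within_open[OF N(2,1)] by (rule vector_derivative_at)
qed

end

section \<open>Flat metrics\<close>

text \<open>Flatness is expressed by \<open>g_T\<close>: in the coordinates of the chart the metric
  is the form \<open>B\<close>, independent of the point. Convexity of \<open>W\<close> provides the
  segments that become geodesics.\<close>

locale flat_chart = subspace_chart E E' W G T T2
  for E :: "'a::euclidean_space set" and E' :: "'b::euclidean_space set" and W G T T2 +
  fixes B :: "'b \<Rightarrow> 'b \<Rightarrow> real" and g :: "'a \<Rightarrow> 'a \<Rightarrow> 'a \<Rightarrow> real"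
  assumes convex_W: "convex W" and B: "bounded_bilinear B" and B_sym: "B k h = B h k"
    and B_pos: "\<And>k. k \<in> E' \<Longrightarrow> k \<noteq> 0 \<Longrightarrow> B k k > 0"
    and g_T: "\<And>y k h. y \<in> W \<Longrightarrow> k \<in> E' \<Longrightarrow> h \<in> E' \<Longrightarrow> g (G y) (T y k) (T y h) = B k h"
begin

section \<open>Levi-Civita connection and parallel fields in flat coordinates\<close>

sublocale B: bounded_bilinear B by (fact B)

lemma g_D: "y \<in> W \<Longrightarrow> X \<in> E \<Longrightarrow> Y \<in> E \<Longrightarrow> g (G y) X Y = B (D y X) (D y Y)"
  using g_T[of y "D y X" "D y Y"] by (simp add: D_in T_D)

lemma B_nondegenerate: "k \<in> E' \<Longrightarrow> (\<And>h. h \<in> E' \<Longrightarrow> B k h = 0) \<Longrightarrow> k = 0"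
  using B_pos by fastforce

text \<open>The tangent vectors stay fixed in the ambient space while the base point moves, so their
  coordinates change at the rate \<open>- D y (T2 y k m)\<close> given by \<open>D_deriv\<close>.
  The product rule for \<open>B\<close> then applies.\<close>

lemma dir_deriv_g:
  assumes y: "y \<in> W" and khl: "k \<in> E'" "h \<in> E'" "l \<in> E'"
  shows "dir_deriv (\<lambda>Q. g Q (T y h) (T y l)) (G y) (T y k)
    = - (B h (D y (T2 y k l)) + B (D y (T2 y k h)) l)"
proof -
  define p where "p = (\<lambda>t::real. G y + t *\<^sub>R T y k)"
  obtain N where N: "open N" "0 \<in> N" and pU: "\<And>t. t \<in> N \<Longrightarrow> p t \<in> U"
    using line_in_U[OF y T_in[OF y khl(1)]] by (metis p_def)
  have der: "((\<lambda>t. D (F (p t)) (T y m)) has_vector_derivative - D y (T2 y k m)) (at 0 within N)"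
    if m: "m \<in> E'" for m
  proof -
    have d1: "((\<lambda>t. (p t, T y m)) has_vector_derivative (T y k, 0)) (at 0 within N)"
      unfolding p_def by (auto intro!: has_vector_derivative_Pair derivative_eq_intros)
    have d2: "((\<lambda>p. D (F (fst p)) (snd p)) has_derivative
      (\<lambda>q. D y (snd q - T2 y (D y (fst q)) m))) (at (p 0, T y m) within (\<lambda>t. (p t, T y m)) ` N)"
      by (rule has_derivative_subset[of _ _ _ "U \<times> E"])
         (use D_deriv[OF y m] pU T_in[OF y m] in \<open>auto simp: p_def\<close>)
    show ?thesis
      using vector_derivative_diff_chain_within[OF d1 d2] D_T[OF y khl(1)]
      by (simp add: o_def linear_neg[OF bounded_linear.linear[OF D_bl[OF y]]])
  qed
  have "((\<lambda>t. B (D (F (p t)) (T y h)) (D (F (p t)) (T y l))) has_vector_derivative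
      B (D (F (p 0)) (T y h)) (- D y (T2 y k l)) + B (- D y (T2 y k h)) (D (F (p 0)) (T y l)))
      (at 0 within N)"
    by (intro B.has_vector_derivative der khl)
  then have "((\<lambda>t. g (p t) (T y h) (T y l)) has_vector_derivative
      B (D (F (p 0)) (T y h)) (- D y (T2 y k l)) + B (- D y (T2 y k h)) (D (F (p 0)) (T y l)))
      (at 0 within N)"
  proof (rule has_vector_derivative_transform[rotated 2])
    show "g (p t) (T y h) (T y l) = B (D (F (p t)) (T y h)) (D (F (p t)) (T y l))" if "t \<in> N" for t
      using pU[OF that] by (metis F_G U_cases g_D khl(2,3) T_in y)
  qed (use N in auto)
  moreover have "D (F (p 0)) (T y m) = m" if "m \<in> E'" for m
    using D_T[OF y that] y by (simp add: p_def)
  ultimately have "((\<lambda>t. g (p t) (T y h) (T y l)) has_vector_derivative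
      - (B h (D y (T2 y k l)) + B (D y (T2 y k h)) l)) (at 0)"
    unfolding at_within_open[OF N(2,1)] using khl
    by (simp only: B.minus_left B.minus_right minus_add_distrib)
  then show ?thesis
    unfolding dir_deriv_def p_def by (rule vector_derivative_at)
qed

text \<open>In Koszul's formula, symmetry of \<open>T2\<close> and \<open>B\<close> cancels four of
  the six terms from \<open>dir_deriv_g\<close>; the other two add up to
  \<open>- 2 * B (D y (T2 y k h)) l\<close>.\<close>

lemma christoffel_T:
  assumes y: "y \<in> W" and kh: "k \<in> E'" "h \<in> E'"
  shows "christoffel E g (G y) (T y k) (T y h) = - T2 y k h"
proof -
  define Q where "Q = (\<lambda>Z. dir_deriv (\<lambda>Q. g Q (T y h) Z) (G y) (T y k)
    + dir_deriv (\<lambda>Q. g Q (T y k) Z) (G y) (T y h) - dir_deriv (\<lambda>Q. g Q (T y k) (T y h)) (G y) Z)"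
  have T2: "T2 y k h \<in> E" using T2_in y kh by simp
  have sol: "2 * g (G y) (- T2 y k h) Z = Q Z" if Z: "Z \<in> E" for Z
  proof -
    obtain l where l: "l \<in> E'" "Z = T y l" using E_cases[OF y Z] .
    have "g (G y) (- T2 y k h) Z = - B (D y (T2 y k h)) l"
      using y l T2 E by (simp add: g_D D_T T_in subspace_neg linear_neg bounded_linear.linear D_bl B.minus_left)
    moreover have "Q Z = - 2 * B (D y (T2 y k h)) l"
      unfolding Q_def l(2) dir_deriv_g[OF y kh l(1)] dir_deriv_g[OF y kh(2,1) l(1)] dir_deriv_g[OF y l(1) kh]
      using T2_sym[OF y] kh l(1) B_sym by (simp add: T2_sym[OF y l(1)])
    ultimately show ?thesis by simp
  qed
  show ?thesis
    unfolding christoffel_def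
  proof (rule the_equality)
    show "- T2 y k h \<in> E \<and> (\<forall>Z\<in>E. 2 * g (G y) (- T2 y k h) Z =
      dir_deriv (\<lambda>Q. g Q (T y h) Z) (G y) (T y k) + dir_deriv (\<lambda>Q. g Q (T y k) Z) (G y) (T y h)
      - dir_deriv (\<lambda>Q. g Q (T y k) (T y h)) (G y) Z)"
      using T2 E sol by (simp add: Q_def subspace_neg)
  next
    fix X assume X: "X \<in> E \<and> (\<forall>Z\<in>E. 2 * g (G y) X Z =
      dir_deriv (\<lambda>Q. g Q (T y h) Z) (G y) (T y k) + dir_deriv (\<lambda>Q. g Q (T y k) Z) (G y) (T y h)
      - dir_deriv (\<lambda>Q. g Q (T y k) (T y h)) (G y) Z)"
    \<comment> \<open>For uniqueness, testing against every \<open>l\<close> in \<open>E'\<close>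
      lets nondegeneracy of \<open>B\<close> identify the coordinates of both solutions.\<close>
    have "B (D y X - D y (- T2 y k h)) l = 0" if l: "l \<in> E'" for l
    proof -
      have "g (G y) X (T y l) = g (G y) (- T2 y k h) (T y l)"
        using bspec[OF conjunct2[OF X] T_in[OF y l]] sol[OF T_in[OF y l]] unfolding Q_def by linarith
      then show ?thesis
        using X y l T2 E T_in[OF y l] by (simp add: g_D subspace_neg B.diff_left D_T)
    qed
    then have "D y X = D y (- T2 y k h)"
      using B_nondegenerate D_in E' y by (metis eq_iff_diff_eq_0 subspace_diff)
    then show "X = - T2 y k h"
      using T_D[OF y] X T2 E by (metis subspace_neg)
  qed
qed

text \<open>Where the velocity is \<open>T y k\<close> and the field is \<open>T y h\<close>,
  parallelism says that the field has derivative \<open>T2 y k h\<close>. By \<open>D_deriv\<close>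
  this cancels the change caused by the moving base point, so the coordinates of \<open>V\<close>
  have derivative zero.\<close>

lemma parallel_along_constant:
  assumes c: "\<And>t. t \<in> {0..1} \<Longrightarrow> c t \<in> U \<and> c differentiable (at t within {0..1}) \<and> velocity c t \<in> E"
    and V: "parallel_along E g c V"
  obtains h where "h \<in> E'" "\<And>t. t \<in> {0..1} \<Longrightarrow> V t = T (F (c t)) h"
proof -
  have "((\<lambda>t. D (F (c t)) (V t)) has_vector_derivative 0) (at t within {0..1})" if t: "t \<in> {0..1}" for t
  proof -
    obtain y where y: "y \<in> W" "c t = G y" using c[OF t] by (auto elim: U_cases)
    obtain h where h: "h \<in> E'" "V t = T y h"
      using V t E_cases[OF y(1)] unfolding parallel_along_def by metis
    obtain k where k: "k \<in> E'" "velocity c t = T y k" using c[OF t] E_cases[OF y(1)] by metis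
    have "(c has_vector_derivative T y k) (at t within {0..1})"
      using c[OF t] k unfolding velocity_def by (metis vector_derivative_works)
    moreover have "(V has_vector_derivative T2 y k h) (at t within {0..1})"
      using V t christoffel_T[OF y(1) k(1) h(1)] unfolding parallel_along_def
      by (metis h(2) k(2) minus_minus y(2))
    ultimately have d1: "((\<lambda>t. (c t, V t)) has_vector_derivative (T y k, T2 y k h)) (at t within {0..1})"
      by (rule has_vector_derivative_Pair)
    have d2: "((\<lambda>p. D (F (fst p)) (snd p)) has_derivative
      (\<lambda>q. D y (snd q - T2 y (D y (fst q)) h))) (at (c t, V t) within (\<lambda>t. (c t, V t)) ` {0..1})"
      by (rule has_derivative_subset[of _ _ _ "U \<times> E"])
         (use D_deriv[OF y(1) h(1)] y h c V in \<open>auto simp: parallel_along_def\<close>)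
    show ?thesis
      using vector_derivative_diff_chain_within[OF d1 d2] D_T[OF y(1) k(1)]
      by (simp add: o_def linear_0[OF bounded_linear.linear[OF D_bl[OF y(1)]]])
  qed
  then obtain h where h: "\<And>t. t \<in> {0..1} \<Longrightarrow> D (F (c t)) (V t) = h"
    using has_vector_derivative_zero_constant[of "{0..1::real}" "\<lambda>t. D (F (c t)) (V t)"]
    by (metis convex_real_interval(5))
  have *: "V t \<in> E" "\<exists>y\<in>W. c t = G y" if "t \<in> {0..1}" for t
    using V c that by (auto simp: parallel_along_def elim!: U_cases)
  show ?thesis
  proof (rule that[of h])
    show "h \<in> E'" using h[of 0] *[of 0] D_in by fastforce
    show "V t = T (F (c t)) h" if "t \<in> {0..1}" for t
      using h[OF that] *[OF that] T_D by fastforce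
  qed
qed

lemma geodesic_velocity:
  assumes "geodesic E U g c" and t: "t \<in> {0..1}"
  shows "c t \<in> U \<and> c differentiable (at t within {0..1}) \<and> velocity c t \<in> E"
  using assms by (auto simp: geodesic_def parallel_along_def)

text \<open>A geodesic has a parallel velocity, hence constant velocity coordinates
  \<open>v\<close>, so \<open>F (c t) - t *\<^sub>R v\<close> is constant. Comparing both ends
  determines \<open>v\<close>; this is the uniqueness behind the definite description in
  \<open>riem_log\<close>.\<close>

lemma geodesic_initial_velocity:
  assumes c: "geodesic E U g c"
  shows "velocity c 0 = T (F (c 0)) (F (c 1) - F (c 0))"
proof -
  note c' = geodesic_velocity[OF c]
  obtain v where v: "v \<in> E'" "\<And>t. t \<in> {0..1} \<Longrightarrow> velocity c t = T (F (c t)) v"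
    using parallel_along_constant[of c "velocity c"] c c' unfolding geodesic_def by metis
  have "((\<lambda>t. F (c t) - t *\<^sub>R v) has_vector_derivative 0) (at t within {0..1})" if t: "t \<in> {0..1}" for t
  proof -
    obtain y where y: "y \<in> W" "c t = G y" using c'[OF t] by (auto elim: U_cases)
    have d1: "(c has_vector_derivative T y v) (at t within {0..1})"
      using c'[OF t] v(2)[OF t] y unfolding velocity_def by (metis F_G vector_derivative_works)
    have d2: "(F has_derivative D y) (at (c t) within c ` {0..1})"
      by (rule has_derivative_subset[of _ _ _ U]) (use F_deriv[OF y(1)] y c' in auto)
    have "((\<lambda>t. F (c t)) has_vector_derivative v) (at t within {0..1})"
      using vector_derivative_diff_chain_within[OF d1 d2] D_T[OF y(1) v(1)] by (simp add: o_def)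
    then show ?thesis
      by (auto intro!: derivative_eq_intros)
  qed
  then obtain a where "\<And>t. t \<in> {0..1} \<Longrightarrow> F (c t) - t *\<^sub>R v = a"
    using has_vector_derivative_zero_constant[of "{0..1::real}" "\<lambda>t. F (c t) - t *\<^sub>R v"]
    by (metis convex_real_interval(5))
  from this[of 0] this[of 1] have "v = F (c 1) - F (c 0)" by (simp add: algebra_simps)
  then show ?thesis using v(2)[of 0] by simp
qed

section \<open>Images of segments: existence of geodesics, logarithm and parallel transport\<close>

context
  fixes y0 y1 :: 'b
  assumes y0: "y0 \<in> W" and y1: "y1 \<in> W"
begin

definition segment where "segment t = y0 + t *\<^sub>R (y1 - y0)"

lemma segment_in: "t \<in> {0..1} \<Longrightarrow> segment t \<in> W"
  using convexD_alt[OF convex_W y0 y1, of t] by (simp add: segment_def algebra_simps)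

lemma diff_in: "y1 - y0 \<in> E'"
  using y0 y1 W_subset E' by (auto intro: subspace_diff)

lemma segment_deriv: "(segment has_vector_derivative (y1 - y0)) (at t within s)"
  unfolding segment_def by (auto intro!: derivative_eq_intros)

lemma G_segment_deriv:
  assumes t: "t \<in> {0..1}"
  shows "((\<lambda>t. G (segment t)) has_vector_derivative T (segment t) (y1 - y0)) (at t within {0..1})"
proof -
  have "(G has_derivative T (segment t)) (at (segment t) within segment ` {0..1})"
    by (rule has_derivative_subset[of _ _ _ W]) (use G_deriv segment_in t in auto)
  from vector_derivative_diff_chain_within[OF segment_deriv this] show ?thesis by (simp add: o_def)
qed

lemma velocity_segment: "t \<in> {0..1} \<Longrightarrow> velocity (\<lambda>t. G (segment t)) t = T (segment t) (y1 - y0)"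
  unfolding velocity_def by (rule vector_derivative_within_closed_interval) (auto intro: G_segment_deriv)

text \<open>The converse of \<open>parallel_along_constant\<close> along a segment. \<open>V\<close>
  is prescribed on the unit interval only, so that the velocity field, known only there, can be
  inserted.\<close>

lemma parallel_along_segment:
  assumes h: "h \<in> E'" and V: "\<And>t. t \<in> {0..1} \<Longrightarrow> V t = T (segment t) h"
  shows "parallel_along E g (\<lambda>t. G (segment t)) V"
  unfolding parallel_along_def
proof (intro ballI conjI)
  fix t :: real assume t: "t \<in> {0..1}"
  show "V t \<in> E" using V t T_in segment_in h by simp
  have d1: "((\<lambda>t. (segment t, h)) has_vector_derivative (y1 - y0, 0)) (at t within {0..1})"
    by (auto intro!: has_vector_derivative_Pair segment_deriv)
  have d2: "((\<lambda>p. T (fst p) (snd p)) has_derivative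
     (\<lambda>q. T2 (segment t) (fst q) h + T (segment t) (snd q)))
     (at (segment t, h) within (\<lambda>t. (segment t, h)) ` {0..1})"
    by (rule has_derivative_subset[OF T_deriv]) (use segment_in t h in auto)
  have "((\<lambda>t. T (segment t) h) has_vector_derivative T2 (segment t) (y1 - y0) h)
      (at t within {0..1})"
    using vector_derivative_diff_chain_within[OF d1 d2] linear_0[OF T_linear[OF segment_in[OF t]]]
    by (simp add: o_def)
  then have "(V has_vector_derivative T2 (segment t) (y1 - y0) h) (at t within {0..1})"
    by (rule has_vector_derivative_transform[rotated 2]) (use t V in auto)
  then show "(V has_vector_derivative - christoffel E g (G (segment t))
      (velocity (\<lambda>t. G (segment t)) t) (V t)) (at t within {0..1})"
    using t by (simp add: velocity_segment V christoffel_T segment_in diff_in h)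
qed

lemma geodesic_segment: "geodesic E U g (\<lambda>t. G (segment t))"
  unfolding geodesic_def
proof (intro conjI ballI)
  fix t :: real assume t: "t \<in> {0..1}"
  show "G (segment t) \<in> U" using segment_in t by simp
  show "(\<lambda>t. G (segment t)) differentiable (at t within {0..1})"
    using G_segment_deriv[OF t] by (rule differentiableI_vector)
next
  \<comment> \<open>The velocity has the constant coordinates \<open>y1 - y0\<close> and is
    therefore itself a parallel field.\<close>
  show "parallel_along E g (\<lambda>t. G (segment t)) (velocity (\<lambda>t. G (segment t)))"
    by (rule parallel_along_segment[OF diff_in velocity_segment])
qed

lemma segment_ends [simp]: "segment 0 = y0" "segment 1 = y1"
  by (simp_all add: segment_def)

lemma riem_log_G: "riem_log E U g (G y0) (G y1) = T y0 (y1 - y0)"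
  unfolding riem_log_def
proof (rule the_equality)
  show "\<exists>c. geodesic E U g c \<and> c 0 = G y0 \<and> c 1 = G y1 \<and> velocity c 0 = T y0 (y1 - y0)"
    using geodesic_segment velocity_segment[of 0] by (intro exI[of _ "\<lambda>t. G (segment t)"]) simp
  show "v = T y0 (y1 - y0)" if "\<exists>c. geodesic E U g c \<and> c 0 = G y0 \<and> c 1 = G y1 \<and> velocity c 0 = v" for v
    using that geodesic_initial_velocity y0 y1 by (metis F_G)
qed

lemma par_transport_G:
  assumes h: "h \<in> E'"
  shows "par_transport E U g (G y0) (G y1) (T y0 h) = T y1 h"
  unfolding par_transport_def
proof (rule the_equality)
  show "\<exists>c V. geodesic E U g c \<and> c 0 = G y0 \<and> c 1 = G y1 \<and> parallel_along E g c V \<and>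
      V 0 = T y0 h \<and> V 1 = T y1 h"
    using geodesic_segment parallel_along_segment[OF h]
    by (intro exI[of _ "\<lambda>t. G (segment t)"] exI[of _ "\<lambda>t. T (segment t) h"]) simp
next
  fix w assume "\<exists>c V. geodesic E U g c \<and> c 0 = G y0 \<and> c 1 = G y1 \<and> parallel_along E g c V \<and>
      V 0 = T y0 h \<and> V 1 = w"
  then obtain c V where cV: "geodesic E U g c" "c 0 = G y0" "c 1 = G y1" "parallel_along E g c V"
    "V 0 = T y0 h" "V 1 = w" by blast
  then obtain l where l: "l \<in> E'" "\<And>t. t \<in> {0..1} \<Longrightarrow> V t = T (F (c t)) l"
    using parallel_along_constant[OF geodesic_velocity[OF cV(1)] cV(4)] by blast
  from l(2)[of 0] have "T y0 l = T y0 h" using cV y0 by simp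
  then have "l = h" using D_T[OF y0] l(1) h by metis
  then show "w = T y1 h" using l(2)[of 1] cV y1 by simp
qed

end

text \<open>The logarithm has coordinates \<open>y1 - y0\<close>, and transport keeps the
  coordinates \<open>h\<close>. In the score the norm cancels against the denominator of the margin
  distance, and the sign restores the absolute value to the bare inner product.\<close>

lemma mlr_score:
  assumes y: "y0 \<in> W" "y1 \<in> W" "z \<in> W" and h: "h \<in> E'"
  defines "A \<equiv> par_transport E U g (G z) (G y0) (T z h)"
  shows "sgn (g (G y0) A (riem_log E U g (G y0) (G y1))) * riem_norm g (G y0) A
    * margin_dist E U g A (G y0) (G y1) = B (y1 - y0) h"
proof -
  have A: "A = T y0 h"
    unfolding A_def by (rule par_transport_G[OF y(3,1) h])
  have g: "g (G y0) A (riem_log E U g (G y0) (G y1)) = B (y1 - y0) h"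
    "g (G y0) (riem_log E U g (G y0) (G y1)) A = B (y1 - y0) h" "g (G y0) A A = B h h"
    unfolding A riem_log_G[OF y(1,2)]
    using g_T[OF y(1)] diff_in[OF y(1,2)] h B_sym[of h "y1 - y0"] by auto
  show ?thesis
  proof (cases "h = 0")
    \<comment> \<open>Here the norm factor is \<open>0\<close>, so the product vanishes whatever
      value the division in \<open>margin_dist\<close> takes.\<close>
    case True
    then show ?thesis using g by (simp add: riem_norm_def B.zero_right)
  next
    case False
    then show ?thesis using g B_pos[OF h] by (simp add: riem_norm_def margin_dist_def sgn_mult_abs)
  qed
qed

end

section \<open>The Cholesky chart\<close>

text \<open>The derivative of \<open>L ** transpose L\<close> in direction \<open>X\<close>, and
  also the polarisation of twice that product. Being symmetric and bilinear, it gives both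
  derivatives of the chart by the product rule.\<close>

definition sprod :: "real^'n^'n \<Rightarrow> real^'n^'n \<Rightarrow> real^'n^'n" where
  "sprod L X = X ** transpose L + L ** transpose X"

lemma sprod_nth: "sprod L X $ i $ j = (\<Sum>k\<in>UNIV. X $ i $ k * L $ j $ k + L $ i $ k * X $ j $ k)"
  by (simp add: sprod_def matrix_matrix_mult_def transpose_def sum.distrib)

lemma sprod_commute: "sprod L X = sprod X L"
  by (simp add: sprod_def add.commute)

lemma bounded_bilinear_sprod: "bounded_bilinear sprod"
  unfolding bilinear_conv_bounded_bilinear[symmetric] bilinear_def linear_iff
  by (simp add: vec_eq_iff sprod_nth algebra_simps sum.distrib sum_distrib_left)

interpretation sprod: bounded_bilinear sprod
  by (fact bounded_bilinear_sprod)

lemma sprod_in_sym: "sprod L X \<in> sym_mats"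
  by (simp add: sym_mats_def vec_eq_iff transpose_def sprod_nth add.commute mult.commute)

lemma sprod_self: "sprod L L = 2 *\<^sub>R (L ** transpose L)"
  by (simp add: sprod_def scaleR_2)

lemma sprod_mat_1: "sprod (mat 1) X = X + transpose X"
  by (simp add: sprod_def transpose_mat)

lemma subspace_sym_mats: "subspace (sym_mats :: (real^'n^'n) set)"
  by (simp add: subspace_def sym_mats_def vec_eq_iff transpose_def)

lemma subspace_lower: "subspace (lower :: ('n::{finite,linorder} sqmat) set)"
  by (simp add: subspace_def lower_def)

lemma lower_ppD: "L \<in> lower_pp \<Longrightarrow> L \<in> lower" "L \<in> lower_pp \<Longrightarrow> 0 < L $ i $ i"
  by (simp_all add: lower_pp_def)

text \<open>The columns of \<open>X\<close> vanish one after another from the left, because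
  \<open>sprod L X = 0\<close> is a triangular system with pivots \<open>L $ j $ j\<close>. The
  induction measure counts the preceding indices, as the index type is only a finite linear
  order.\<close>

lemma sprod_lower_inj:
  fixes L X :: "'n::{finite,linorder} sqmat"
  assumes L: "L \<in> lower_pp" and X: "X \<in> lower" and 0: "sprod L X = 0"
  shows "X = 0"
proof -
  have "\<forall>i. X $ i $ j = 0" for j
  proof (induction "card {..<j}" arbitrary: j rule: less_induct)
    case less
    have IH: "X $ i $ k = 0" if "k < j" for i k
      using that by (intro less[rule_format] psubset_card_mono) auto
    \<comment> \<open>In entry \<open>(i, j)\<close> the summands with \<open>k < j\<close> vanish
      by induction, and those with \<open>k > j\<close> because row \<open>j\<close> of both
      matrices is zero there.\<close>
    have eq: "X $ i $ j * L $ j $ j + L $ i $ j * X $ j $ j = 0" if "j \<le> i" for i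
    proof -
      have "0 = (\<Sum>k\<in>UNIV. X $ i $ k * L $ j $ k + L $ i $ k * X $ j $ k)"
        using 0 by (simp flip: sprod_nth)
      also have "\<dots> = (\<Sum>k\<in>{j}. X $ i $ k * L $ j $ k + L $ i $ k * X $ j $ k)"
      proof (rule sum.mono_neutral_right)
        show "\<forall>k\<in>UNIV - {j}. X $ i $ k * L $ j $ k + L $ i $ k * X $ j $ k = 0"
        proof
          fix k assume "k \<in> UNIV - {j}"
          then consider "k < j" | "j < k" by fastforce
          then show "X $ i $ k * L $ j $ k + L $ i $ k * X $ j $ k = 0"
            using IH L X by cases (auto simp: lower_pp_def lower_def)
        qed
      qed auto
      finally show ?thesis by simp
    qed
    have "X $ j $ j = 0" using eq[of j] lower_ppD(2)[OF L, of j] by auto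
    then have "X $ i $ j = 0" if "j \<le> i" for i
      using eq[OF that] lower_ppD(2)[OF L, of j] by auto
    moreover have "X $ i $ j = 0" if "i < j" for i
      using X that by (simp add: lower_def)
    ultimately show ?case by (meson leI)
  qed
  then show ?thesis by (simp add: vec_eq_iff)
qed

text \<open>\<open>sym_of_lower\<close> restricts to a linear bijection between the two spaces.
  Equality of dimensions is what invariance of domain requires.\<close>

lemma dim_lower: "dim (lower :: ('n::{finite,linorder} sqmat) set) = dim (sym_mats :: ('n sqmat) set)"
proof -
  have lin: "linear (sym_of_lower :: 'n sqmat \<Rightarrow> _)"
    by (simp add: linear_iff sym_of_lower_def vec_eq_iff)
  have "inj_on sym_of_lower (lower :: ('n sqmat) set)"
  proof (rule inj_onI)
    fix X Y :: "'n sqmat" assume XY: "X \<in> lower" "Y \<in> lower" and eq: "sym_of_lower X = sym_of_lower Y"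
    have "X $ i $ j = Y $ i $ j" for i j
      using XY arg_cong[OF eq, of "\<lambda>Z. Z $ i $ j"]
      by (cases "j \<le> i") (auto simp: sym_of_lower_def lower_def)
    then show "X = Y" by (simp add: vec_eq_iff)
  qed
  moreover have "sym_of_lower ` lower = (sym_mats :: ('n sqmat) set)"
  proof (intro equalityI subsetI)
    fix P :: "'n sqmat" assume P: "P \<in> sym_mats"
    have P': "P $ i $ j = P $ j $ i" for i j
      using P by (metis (mono_tags) mem_Collect_eq sym_mats_def transpose_def vec_lambda_beta)
    show "P \<in> sym_of_lower ` lower"
      by (rule image_eqI[of _ _ "\<chi> i j. if j \<le> i then P $ i $ j else 0"])
         (auto simp: sym_of_lower_def lower_def vec_eq_iff P')
  qed (auto simp: sym_of_lower_def sym_mats_def transpose_def vec_eq_iff)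
  ultimately show ?thesis
    using dim_image_eq[OF lin, of lower] subspace_lower span_eq_iff[of lower] by metis
qed

section \<open>Powers of the diagonal and their derivatives\<close>

lemma has_derivative_matrixI:
  fixes f :: "'a::real_normed_vector \<Rightarrow> real^'n^'m"
  assumes "\<And>i j. ((\<lambda>x. f x $ i $ j) has_derivative (\<lambda>x. f' x $ i $ j)) (at a within S)"
  shows "(f has_derivative f') (at a within S)"
proof (subst has_derivative_componentwise_within, rule ballI)
  fix b :: "real^'n^'m" assume "b \<in> Basis"
  then obtain i j where "b = axis i (axis j 1)" by (auto simp: Basis_vec_def)
  then show "((\<lambda>x. f x \<bullet> b) has_derivative (\<lambda>x. f' x \<bullet> b)) (at a within S)"
    using assms[of i j] by (simp add: inner_axis)
qed

lemma has_derivative_matrix_nth: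
  "((\<lambda>Y::real^'n^'m. Y $ i $ j) has_derivative (\<lambda>K. K $ i $ j)) (at a within S)"
  by (intro bounded_linear_imp_has_derivative bounded_linear_compose[OF bounded_linear_vec_nth]) auto

lemma has_derivative_powr_const:
  fixes f :: "'a::real_normed_vector \<Rightarrow> real"
  assumes "(f has_derivative f') (at a within S)" "f a > 0"
  shows "((\<lambda>x. f x powr r) has_derivative (\<lambda>h. f' h * (r * f a powr (r - 1)))) (at a within S)"
  by (rule DERIV_compose_FDERIV[OF has_real_derivative_powr[OF assms(2)] assms(1)])

text \<open>This is the map \<open>\<psi>\<close> with exponent \<open>r\<close>; the two
  definitions that follow are its first and second derivatives, the second one diagonal because
  off-diagonal entries enter linearly.\<close>

definition dscale :: "real \<Rightarrow> 'n::finite sqmat \<Rightarrow> 'n sqmat" where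
  "dscale r Y = (\<chi> i j. if i = j then Y $ i $ i powr r else Y $ i $ j)"

definition dscale' :: "real \<Rightarrow> 'n::finite sqmat \<Rightarrow> 'n sqmat \<Rightarrow> 'n sqmat" where
  "dscale' r Y K = (\<chi> i j. if i = j then r * Y $ i $ i powr (r - 1) * K $ i $ i else K $ i $ j)"

definition dscale'' :: "real \<Rightarrow> 'n::finite sqmat \<Rightarrow> 'n sqmat \<Rightarrow> 'n sqmat \<Rightarrow> 'n sqmat" where
  "dscale'' r Y K H = (\<chi> i j. if i = j then r * (r - 1) * Y $ i $ i powr (r - 2) * K $ i $ i * H $ i $ i else 0)"

lemma dscale_deriv:
  fixes Y :: "'n::{finite,linorder} sqmat"
  assumes "Y \<in> lower_pp"
  shows "(dscale r has_derivative dscale' r Y) (at Y within S)"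
proof (rule has_derivative_matrixI)
  fix i j
  show "((\<lambda>Y. dscale r Y $ i $ j) has_derivative (\<lambda>K. dscale' r Y K $ i $ j)) (at Y within S)"
    using has_derivative_powr_const[OF has_derivative_matrix_nth[of i i Y S] lower_ppD(2)[OF assms], of r]
      has_derivative_matrix_nth[of i j Y S]
    by (cases "i = j") (auto simp: dscale_def dscale'_def algebra_simps)
qed

lemma dscale'_deriv:
  fixes Y :: "'n::{finite,linorder} sqmat"
  assumes Y: "Y \<in> lower_pp"
  shows "((\<lambda>p. dscale' r (fst p) (snd p)) has_derivative (\<lambda>q. dscale'' r Y (fst q) H + dscale' r Y (snd q)))
    (at (Y, H) within S)"
proof (rule has_derivative_matrixI)
  fix i j
  have nth: "((\<lambda>p::('n sqmat)\<times>('n sqmat). fst p $ i $ j) has_derivative (\<lambda>q. fst q $ i $ j)) (at (Y, H) within S)"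
   "((\<lambda>p::('n sqmat)\<times>('n sqmat). snd p $ i $ j) has_derivative (\<lambda>q. snd q $ i $ j)) (at (Y, H) within S)" for i j
    by (intro bounded_linear_imp_has_derivative bounded_linear_compose[OF bounded_linear_vec_nth]
        bounded_linear_fst bounded_linear_snd)+
  have "((\<lambda>p::('n sqmat)\<times>('n sqmat). fst p $ i $ i powr (r - 1)) has_derivative
      (\<lambda>q. fst q $ i $ i * ((r - 1) * Y $ i $ i powr (r - 2)))) (at (Y, H) within S)"
    using has_derivative_powr_const[OF nth(1), of i i "r - 1"] lower_ppD(2)[OF Y] by (simp add: algebra_simps)
  note d = has_derivative_mult[OF has_derivative_mult_right[OF this, of r] nth(2)[of i i]]
  show "((\<lambda>p. dscale' r (fst p) (snd p) $ i $ j) has_derivative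
      (\<lambda>q. (dscale'' r Y (fst q) H + dscale' r Y (snd q)) $ i $ j)) (at (Y, H) within S)"
    using d nth(2)[of i j]
    by (cases "i = j") (auto simp: dscale'_def dscale''_def algebra_simps)
qed

lemma dscale_in: "Y \<in> lower_pp \<Longrightarrow> dscale r Y \<in> lower_pp"
  by (auto simp: dscale_def lower_pp_def lower_def) (metis less_irrefl)

lemma dscale_dscale: "Y \<in> lower_pp \<Longrightarrow> r * s = 1 \<Longrightarrow> dscale r (dscale s Y) = Y"
  by (auto simp: dscale_def vec_eq_iff powr_powr mult.commute abs_of_pos lower_ppD(2))

lemma dscale'_in: "K \<in> lower \<Longrightarrow> dscale' r Y K \<in> lower"
  by (auto simp: dscale'_def lower_def)

lemma dscale'_ker:
  assumes "Y \<in> lower_pp" "r \<noteq> 0" "dscale' r Y K = 0"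
  shows "K = 0"
proof -
  have "K $ i $ j = 0" for i j
    using assms(2) lower_ppD(2)[OF assms(1), of i] arg_cong[OF assms(3), of "\<lambda>Z. Z $ i $ j"]
    by (cases "i = j") (auto simp: dscale'_def)
  then show ?thesis by (simp add: vec_eq_iff)
qed

text \<open>A difference of squares: \<open>sprod (K + L) (K - L)\<close> is twice the difference of
  the two products. As \<open>K + L\<close> again has positive diagonal,
  \<open>sprod_lower_inj\<close> forces \<open>K - L = 0\<close>.\<close>

lemma inj_on_chol_prod: "inj_on (\<lambda>L. L ** transpose L) (lower_pp :: ('n::{finite,linorder} sqmat) set)"
proof (rule inj_onI)
  fix K L :: "'n sqmat"
  assume KL: "K \<in> lower_pp" "L \<in> lower_pp" and eq: "K ** transpose K = L ** transpose L"
  have "sprod (K + L) (K - L) = sprod K K - sprod L L"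
    by (simp add: sprod.add_left sprod.diff_right sprod_commute[of L K])
  then have "sprod (K + L) (K - L) = 0"
    by (simp add: sprod_self eq)
  moreover have "K + L \<in> lower_pp" "K - L \<in> lower"
    using KL by (simp_all add: lower_pp_def lower_def add_pos_pos)
  ultimately show "K = L"
    using sprod_lower_inj by fastforce
qed

definition chart_map :: "real \<Rightarrow> 'n::finite sqmat \<Rightarrow> 'n sqmat" where
  "chart_map r Y = dscale r Y ** transpose (dscale r Y)"

definition chart_map' :: "real \<Rightarrow> 'n::finite sqmat \<Rightarrow> 'n sqmat \<Rightarrow> 'n sqmat" where
  "chart_map' r Y K = sprod (dscale r Y) (dscale' r Y K)"

definition chart_map'' :: "real \<Rightarrow> 'n::finite sqmat \<Rightarrow> 'n sqmat \<Rightarrow> 'n sqmat \<Rightarrow> 'n sqmat" where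
  "chart_map'' r Y K H = sprod (dscale' r Y K) (dscale' r Y H) + sprod (dscale r Y) (dscale'' r Y K H)"

lemma openin_lower_pp: "openin (top_of_set lower) (lower_pp :: ('n::{finite,linorder} sqmat) set)"
proof -
  have "open {A :: 'n sqmat. \<forall>i. 0 < A $ i $ i}"
    unfolding Collect_all_eq by (intro open_INT ballI open_Collect_less continuous_intros) auto
  moreover have "lower_pp = lower \<inter> {A :: 'n sqmat. \<forall>i. 0 < A $ i $ i}"
    by (auto simp: lower_pp_def)
  ultimately show ?thesis unfolding openin_open by blast
qed

text \<open>Injectivity and trivial kernels compose from the power map, invertible because
  \<open>r \<noteq> 0\<close>, and the Cholesky product; the derivatives come from bilinearity of
  \<open>sprod\<close>.\<close>

lemma subspace_chart_chol:
  assumes r: "r \<noteq> 0"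
  shows "subspace_chart sym_mats (lower :: ('n::{finite,linorder} sqmat) set) lower_pp
    (chart_map r) (chart_map' r) (chart_map'' r)"
proof
  show "subspace (sym_mats :: 'n sqmat set)" by (rule subspace_sym_mats)
  show "subspace (lower :: 'n sqmat set)" by (rule subspace_lower)
  show "dim (lower :: 'n sqmat set) = dim (sym_mats :: 'n sqmat set)" by (rule dim_lower)
  show "openin (top_of_set lower) (lower_pp :: 'n sqmat set)" by (rule openin_lower_pp)
  show "inj_on (chart_map r) (lower_pp :: ('n sqmat) set)"
  proof (rule inj_onI)
    fix X Y :: "'n sqmat"
    assume "X \<in> lower_pp" "Y \<in> lower_pp" "chart_map r X = chart_map r Y"
    then show "X = Y"
      using inj_onD[OF inj_on_chol_prod] dscale_in dscale_dscale[of _ "1 / r" r] r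
      unfolding chart_map_def by (metis nonzero_eq_divide_eq)
  qed
  fix y k h :: "'n sqmat"
  show "chart_map r y \<in> sym_mats"
    by (simp add: chart_map_def sym_mats_def matrix_transpose_mul)
  show "chart_map' r y k \<in> sym_mats"
    by (simp add: chart_map'_def sprod_in_sym)
  show "chart_map'' r y k h \<in> sym_mats"
    by (simp add: chart_map''_def sprod_in_sym subspace_sym_mats subspace_add)
  have "dscale'' r y k h = dscale'' r y h k"
    by (simp add: dscale''_def vec_eq_iff)
  then show "chart_map'' r y k h = chart_map'' r y h k"
    by (simp add: chart_map''_def sprod_commute[of "dscale' r y k"])
  assume y: "y \<in> lower_pp"
  show "k = 0" if "k \<in> lower" "chart_map' r y k = 0"
    using that unfolding chart_map'_def
    by (metis dscale'_ker[OF y r] sprod_lower_inj[OF dscale_in[OF y]] dscale'_in)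
  have "((\<lambda>Y. (1/2) *\<^sub>R sprod (dscale r Y) (dscale r Y)) has_derivative
      (\<lambda>K. (1/2) *\<^sub>R (sprod (dscale r y) (dscale' r y K) + sprod (dscale' r y K) (dscale r y)))) (at y within lower_pp)"
    by (intro has_derivative_scaleR_right sprod.FDERIV dscale_deriv y)
  moreover have "(1/2) *\<^sub>R (sprod (dscale r y) (dscale' r y K) + sprod (dscale' r y K) (dscale r y)) = chart_map' r y K" for K
    unfolding chart_map'_def sprod_commute[of "dscale' r y K" "dscale r y"] by simp
  ultimately show "(chart_map r has_derivative chart_map' r y) (at y within lower_pp)"
    by (simp add: sprod_self chart_map_def[abs_def])
  have "((\<lambda>p. dscale r (fst p)) has_derivative (\<lambda>q. dscale' r y (fst q))) (at (y, h) within lower_pp \<times> lower)"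
    by (rule has_derivative_compose[OF bounded_linear_imp_has_derivative[OF bounded_linear_fst]])
       (use dscale_deriv[OF y, of r UNIV] in simp)
  from sprod.FDERIV[OF this dscale'_deriv[OF y]]
  show "((\<lambda>p. chart_map' r (fst p) (snd p)) has_derivative
      (\<lambda>q. chart_map'' r y (fst q) h + chart_map' r y (snd q))) (at (y, h) within lower_pp \<times> lower)"
    by (simp add: chart_map'_def chart_map''_def sprod.add_right algebra_simps)
qed

section \<open>Existence of the Cholesky decomposition\<close>

lemma inner_chol_prod: "x \<bullet> ((L ** transpose L) *v x) = (transpose L *v x) \<bullet> (transpose L *v x)"
  for L :: "real^'n^'n"
  by (metis dot_lmul_matrix matrix_vector_mul_assoc transpose_matrix_vector)

text \<open>The quadratic form at \<open>x\<close> is the squared norm of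
  \<open>transpose L *v x\<close>. At the last index \<open>i\<close> where \<open>x\<close> is
  nonzero, triangularity leaves the single entry \<open>L $ i $ i * x $ i\<close>, so this vector is
  nonzero.\<close>

lemma chol_prod_spd:
  fixes L :: "'n::{finite,linorder} sqmat"
  assumes L: "L \<in> lower_pp"
  shows "L ** transpose L \<in> spd"
proof -
  have "transpose L *v x \<noteq> 0" if "x \<noteq> 0" for x
  proof -
    define i where "i = Max {i. x $ i \<noteq> 0}"
    have ne: "{i. x $ i \<noteq> 0} \<noteq> {}" using that by (auto simp: vec_eq_iff)
    have i: "x $ i \<noteq> 0"
      using Max_in[OF _ ne] by (auto simp: i_def)
    have i': "x $ j = 0" if "i < j" for j
    proof (rule ccontr)
      assume "x $ j \<noteq> 0"
      then have "j \<le> i" unfolding i_def by (intro Max_ge) auto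
      with that show False by simp
    qed
    have "(transpose L *v x) $ i = (\<Sum>j\<in>UNIV. L $ j $ i * x $ j)"
      by (simp add: matrix_vector_mult_def transpose_def)
    also have "\<dots> = (\<Sum>j\<in>{i}. L $ j $ i * x $ j)"
    proof (rule sum.mono_neutral_right)
      show "\<forall>j\<in>UNIV - {i}. L $ j $ i * x $ j = 0"
      proof
        fix j assume "j \<in> UNIV - {i}"
        then consider "j < i" | "i < j" by fastforce
        then show "L $ j $ i * x $ j = 0"
          using i' L by cases (auto simp: lower_pp_def lower_def)
      qed
    qed auto
    finally have "(transpose L *v x) $ i = L $ i $ i * x $ i" by simp
    then show ?thesis
      using i lower_ppD(2)[OF L, of i] by (metis less_irrefl mult_eq_0_iff zero_index)
  qed
  then show ?thesis
    by (simp add: spd_def inner_chol_prod matrix_transpose_mul)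
qed

text \<open>Positive definiteness makes \<open>transpose L\<close> injective. If
  \<open>L $ i $ i\<close> were zero, it would map the vectors supported on indices up to
  \<open>i\<close> into those supported strictly below \<open>i\<close>, a space of smaller
  dimension.\<close>

lemma lower_diag_nonzero:
  fixes L :: "'n::{finite,linorder} sqmat"
  assumes L: "L \<in> lower" and P: "L ** transpose L \<in> spd"
  shows "L $ i $ i \<noteq> 0"
proof
  assume 0: "L $ i $ i = 0"
  define S where "S = {x :: (real, 'n) vec. \<forall>j>i. x $ j = 0}"
  define S' where "S' = {x :: (real, 'n) vec. \<forall>j\<ge>i. x $ j = 0}"
  let ?f = "\<lambda>x. transpose L *v x"
  have sub: "subspace S" "subspace S'" by (auto simp: S_def S'_def subspace_def)
  have inj: "inj_on ?f S"
  proof (rule inj_onI)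
    fix x y assume "?f x = ?f y"
    then have "?f (x - y) = 0" by (simp add: matrix_vector_mult_diff_distrib)
    then have "(x - y) \<bullet> ((L ** transpose L) *v (x - y)) = 0" unfolding inner_chol_prod by simp
    moreover have "0 < (x - y) \<bullet> ((L ** transpose L) *v (x - y))" if "x \<noteq> y"
      using P that unfolding spd_def by simp
    ultimately show "x = y" by fastforce
  qed
  have im: "?f ` S \<subseteq> S'"
  proof (rule image_subsetI)
    fix x assume x: "x \<in> S"
    have "L $ j $ k * x $ j = 0" if "i \<le> k" for j k
    proof (cases "j < k")
      case True
      then show ?thesis using L by (simp add: lower_def)
    next
      case False
      then show ?thesis using that x 0 by (cases "j = i") (auto simp: S_def)
    qed
    then have "(\<Sum>j\<in>UNIV. L $ j $ k * x $ j) = 0" if "i \<le> k" for k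
      using that by (intro sum.neutral ballI)
    then show "?f x \<in> S'"
      by (simp add: S'_def matrix_vector_mult_def transpose_def)
  qed
  have "dim S = dim (?f ` S)"
    using dim_image_eq[OF matrix_vector_mul_linear, of "transpose L" S] inj
    unfolding span_eq_iff[THEN iffD2, OF sub(1)] by simp
  also have "\<dots> \<le> dim S'" by (rule dim_subset[OF im])
  finally have "S' = S"
    by (intro subspace_dim_equal[OF sub(2,1)]) (auto simp: S_def S'_def)
  moreover have "axis i 1 \<in> S" "axis i 1 \<notin> S'"
    by (auto simp: S_def S'_def axis_def)
  ultimately show False by simp
qed

lemma spd_subset_sym: "spd \<subseteq> sym_mats"
  by (auto simp: spd_def sym_mats_def)

lemma mat_1_lower_pp: "mat 1 \<in> lower_pp"
  by (auto simp: lower_pp_def lower_def mat_def)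

text \<open>The image of \<open>L \<mapsto> L L\<^sup>T\<close> is open in the symmetric matrices by invariance of domain and closed
  in the cone \<open>spd\<close> by compactness; the cone is convex, hence connected.\<close>

lemma chol_prod_image: "(\<lambda>L. L ** transpose L) ` lower_pp = (spd :: ('n::{finite,linorder} sqmat) set)"
proof -
  let ?V = "(\<lambda>L. L ** transpose L) ` (lower_pp :: 'n sqmat set)"
  have sub: "?V \<subseteq> spd" using chol_prod_spd by blast
  interpret C: subspace_chart sym_mats "lower :: 'n sqmat set" lower_pp "chart_map 1" "chart_map' 1" "chart_map'' 1"
    by (rule subspace_chart_chol) simp
  \<comment> \<open>With exponent \<open>1\<close> the chart is the plain Cholesky product, so its
    image is the open set \<open>C.U\<close>.\<close>
  have "dscale 1 Y = Y" if "Y \<in> lower_pp" for Y :: "'n sqmat"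
    using lower_ppD(2)[OF that] by (simp add: dscale_def vec_eq_iff less_imp_le)
  then have "?V = C.U"
    unfolding C.U_def by (intro image_cong) (auto simp: chart_map_def)
  then have op: "openin (top_of_set spd) ?V"
    using C.U_open sub spd_subset_sym by (metis openin_subset_trans)
  have cl: "closedin (top_of_set spd) ?V"
    unfolding closedin_limpt
  proof (intro conjI sub allI impI, elim conjE)
    fix P :: "'n sqmat" assume P: "P islimpt ?V" "P \<in> spd"
    have cont: "continuous_on UNIV (\<lambda>L::'n sqmat. L ** transpose L)"
    proof -
      have "continuous_on UNIV (\<lambda>L::'n sqmat. (1/2) *\<^sub>R sprod L L)"
        by (intro continuous_intros sprod.continuous_on)
      then show ?thesis by (simp add: sprod_self)
    qed
    obtain Q where Q: "\<And>n. Q n \<in> ?V" "Q \<longlonglongrightarrow> P"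
      using P(1) unfolding islimpt_sequential by blast
    have "\<forall>n. \<exists>L. L \<in> lower_pp \<and> Q n = L ** transpose L"
      using Q(1) by blast
    then obtain L where L: "\<And>n. L n \<in> lower_pp" "\<And>n. Q n = L n ** transpose (L n)"
      by metis
    \<comment> \<open>The squared Frobenius norm of a factor is the trace of its product. Traces
      converge along \<open>Q\<close>, so the factors are bounded and have a convergent
      subsequence.\<close>
    have "norm (L n) ^ 2 = (\<Sum>i\<in>UNIV. Q n $ i $ i)" for n
      by (simp add: power2_norm_eq_inner inner_vec_def L(2) matrix_matrix_mult_def transpose_def)
    moreover have "(\<lambda>n. \<Sum>i\<in>UNIV. Q n $ i $ i) \<longlonglongrightarrow> (\<Sum>i\<in>UNIV. P $ i $ i)"
      by (intro tendsto_intros Q)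
    ultimately have "Bseq (\<lambda>n. norm (L n) ^ 2)"
      by (metis (no_types, lifting) ext convergentI convergent_imp_Bseq)
    then obtain c where c: "\<And>n. norm (L n) ^ 2 \<le> c"
      unfolding Bseq_def by auto
    have "norm (L n) \<le> sqrt c" for n
      using c[of n] real_le_rsqrt by blast
    then have "bounded (range L)"
      unfolding bounded_iff by blast
    then obtain l r where l: "strict_mono r" "(L \<circ> r) \<longlonglongrightarrow> l"
      using bounded_imp_convergent_subsequence by blast
    have ent: "(\<lambda>n. L (r n) $ i $ j) \<longlonglongrightarrow> l $ i $ j" for i j
      using l(2) by (auto intro!: tendsto_intros simp: o_def)
    have "l $ i $ j = 0" if "i < j" for i j
    proof -
      have "L (r n) $ i $ j = 0" for n using L(1)[of "r n"] that by (simp add: lower_pp_def lower_def)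
      then show ?thesis using ent[of i j] by (simp add: LIMSEQ_const_iff)
    qed
    then have low: "l \<in> lower" by (simp add: lower_def)
    have "(\<lambda>n. Q (r n)) \<longlonglongrightarrow> l ** transpose l"
      using continuous_on_tendsto_compose[OF cont l(2)] by (simp add: L(2) o_def)
    moreover have "(\<lambda>n. Q (r n)) \<longlonglongrightarrow> P"
      using LIMSEQ_subseq_LIMSEQ[OF Q(2) l(1)] by (simp add: o_def)
    ultimately have lP: "P = l ** transpose l" by (metis LIMSEQ_unique)
    \<comment> \<open>The limit only keeps nonnegative diagonal entries; \<open>P \<in> spd\<close>
      excludes zeros through \<open>lower_diag_nonzero\<close>.\<close>
    have "0 \<le> l $ i $ i" for i
      by (rule LIMSEQ_le_const[OF ent]) (use L(1) in \<open>auto simp: lower_pp_def intro: less_imp_le\<close>)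
    then have "l \<in> lower_pp"
      using low lower_diag_nonzero[OF low] P(2) lP by (simp add: lower_pp_def order_le_less)
    then show "P \<in> ?V" using lP by blast
  qed
  have "convex (spd :: 'n sqmat set)"
    unfolding convex_def
  proof (intro ballI allI impI)
    fix P Q :: "'n sqmat" and u v :: real
    assume P: "P \<in> spd" and Q: "Q \<in> spd" and uv: "0 \<le> u" "0 \<le> v" "u + v = 1"
    have "0 < x \<bullet> ((u *\<^sub>R P + v *\<^sub>R Q) *v x)" if x: "x \<noteq> 0" for x
    proof -
      have "x \<bullet> ((u *\<^sub>R P + v *\<^sub>R Q) *v x) = u * (x \<bullet> (P *v x)) + v * (x \<bullet> (Q *v x))"
        by (simp add: matrix_vector_mult_add_rdistrib inner_add_right flip: scaleR_matrix_vector_assoc)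
      moreover have "0 < x \<bullet> (P *v x)" "0 < x \<bullet> (Q *v x)"
        using P Q x by (auto simp: spd_def)
      ultimately show ?thesis
        using uv by (cases "u = 0") (auto intro: add_pos_nonneg)
    qed
    moreover have "u *\<^sub>R P + v *\<^sub>R Q \<in> sym_mats"
      using P Q spd_subset_sym by (intro subspace_add subspace_scale subspace_sym_mats) auto
    ultimately show "u *\<^sub>R P + v *\<^sub>R Q \<in> spd" by (simp add: spd_def sym_mats_def)
  qed
  then have "connected (spd :: 'n sqmat set)" by (rule convex_connected)
  moreover have "?V \<noteq> {}" using mat_1_lower_pp by blast
  ultimately show ?thesis using op cl unfolding connected_clopen by blast
qed

lemma chol_unique:
  fixes L :: "'n::{finite,linorder} sqmat"
  assumes "L \<in> lower_pp" shows "chol (L ** transpose L) = L"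
  unfolding chol_def using assms inj_onD[OF inj_on_chol_prod] by (intro the_equality) auto

lemma chart_map_image:
  assumes r: "r \<noteq> 0"
  shows "chart_map r ` lower_pp = (spd :: ('n::{finite,linorder} sqmat) set)"
proof -
  have "dscale r ` lower_pp = (lower_pp :: 'n sqmat set)"
  proof (intro equalityI subsetI)
    fix L :: "'n sqmat" assume L: "L \<in> lower_pp"
    show "L \<in> dscale r ` lower_pp"
      using dscale_dscale[OF L, of r "1 / r"] dscale_in[OF L, of "1 / r"] r by (intro image_eqI) auto
  qed (use dscale_in in blast)
  then show ?thesis
    unfolding chart_map_def[abs_def] by (metis (no_types, lifting) chol_prod_image image_image image_cong)
qed

section \<open>The two Cholesky metrics\<close>

text \<open>The common shape of both metrics in flat coordinates, which differ only in the diagonal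
  weights \<open>w\<close>. Strictly upper entries do not enter, so definiteness holds on
  \<open>lower\<close>.\<close>

definition flat_form :: "('n \<Rightarrow> real) \<Rightarrow> 'n::{finite,linorder} sqmat \<Rightarrow> 'n sqmat \<Rightarrow> real" where
  "flat_form w X Y = slow X \<bullet> slow Y + (\<Sum>i\<in>UNIV. w i * (X $ i $ i * Y $ i $ i))"

lemma slow_add: "slow (X + Y) = slow X + slow Y" and slow_diff: "slow (X - Y) = slow X - slow Y"
  and slow_scaleR: "slow (c *\<^sub>R X) = c *\<^sub>R slow X"
  by (simp_all add: slow_def vec_eq_iff)

lemma flat_form_commute: "flat_form w X Y = flat_form w Y X"
  by (simp add: flat_form_def inner_commute mult.commute)

lemma bounded_bilinear_flat_form: "bounded_bilinear (flat_form w)"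
  unfolding bilinear_conv_bounded_bilinear[symmetric] bilinear_def linear_iff
  by (simp add: flat_form_def slow_add slow_scaleR inner_add_left inner_add_right algebra_simps
      sum.distrib sum_distrib_left)

lemma flat_form_pos:
  assumes w: "\<And>i. w i > 0" and X: "X \<in> lower" "X \<noteq> 0"
  shows "flat_form w X X > 0"
proof (rule ccontr)
  assume neg: "\<not> flat_form w X X > 0"
  have nn: "0 \<le> w i * (X $ i $ i * X $ i $ i)" for i
    using w[of i] by simp
  have "0 \<le> slow X \<bullet> slow X" "0 \<le> (\<Sum>i\<in>UNIV. w i * (X $ i $ i * X $ i $ i))"
    using nn by (auto intro: sum_nonneg)
  with neg have 0: "slow X \<bullet> slow X = 0" "(\<Sum>i\<in>UNIV. w i * (X $ i $ i * X $ i $ i)) = 0"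
    unfolding flat_form_def by linarith+
  have d: "X $ i $ i = 0" for i
  proof -
    have "w i * (X $ i $ i * X $ i $ i) = 0"
      using 0(2) nn by (subst (asm) sum_nonneg_eq_0_iff) auto
    then show ?thesis using w[of i] by simp
  qed
  have "X $ i $ j = 0" for i j
  proof (cases i j rule: linorder_cases)
    case less
    then show ?thesis using X by (simp add: lower_def)
  next
    case greater
    have "slow X $ i $ j = 0" using 0(1) by simp
    then show ?thesis using greater by (simp add: slow_def)
  qed (use d in auto)
  then show False using X(2) by (simp add: vec_eq_iff)
qed

section \<open>Diagonal matrices and the two metrics in flat coordinates\<close>

definition diag_mat :: "('n \<Rightarrow> real) \<Rightarrow> 'n::finite sqmat" where
  "diag_mat a = (\<chi> i j. if i = j then a i else 0)"

lemma inner_diag_mat: "diag_mat a \<bullet> diag_mat b = (\<Sum>i\<in>UNIV. a i * b i)"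
proof -
  have "(if i = j then a i else 0) * (if i = j then b i else 0) = (if i = j then a i * b i else 0)" for i j
    by simp
  then show ?thesis by (simp add: diag_mat_def inner_vec_def)
qed

lemma diag_mat_mult: "diag_mat a ** diag_mat b = diag_mat (\<lambda>i. a i * b i)"
proof -
  have "(if i = k then a i else 0) * (if k = j then b k else 0)
      = (if k = i then if i = j then a i * b i else 0 else 0)" for i j k
    by simp
  then show ?thesis by (simp add: diag_mat_def matrix_matrix_mult_def vec_eq_iff)
qed

lemma diag_mat_diff: "diag_mat a - diag_mat b = diag_mat (\<lambda>i. a i - b i)"
  by (simp add: diag_mat_def vec_eq_iff)

lemma dg_diag_mat: "dg X = diag_mat (\<lambda>i. X $ i $ i)"
  by (simp add: dg_def diag_mat_def vec_eq_iff)

lemma dpow_dg: "dpow (dg X) a = diag_mat (\<lambda>i. X $ i $ i powr a)"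
  by (simp add: dpow_def dg_def diag_mat_def vec_eq_iff)

lemma matrix_inv_diag_pp:
  assumes M: "M \<in> diag_pp"
  shows "matrix_inv M = diag_mat (\<lambda>i. 1 / M $ i $ i)"
proof -
  define N where "N = diag_mat (\<lambda>i. 1 / M $ i $ i)"
  have M': "M = diag_mat (\<lambda>i. M $ i $ i)" and nz: "M $ i $ i \<noteq> 0" for i
    using M by (auto simp: diag_pp_def diag_mat_def vec_eq_iff) (metis less_irrefl)
  have one: "diag_mat (\<lambda>i. 1) = mat 1" by (simp add: diag_mat_def mat_def)
  have NM: "N ** M = mat 1"
    by (subst M') (simp add: N_def diag_mat_mult nz one)
  have MN: "M ** N = mat 1"
    by (subst M') (simp add: N_def diag_mat_mult nz one)
  have "\<exists>N. M ** N = mat 1 \<and> N ** M = mat 1"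
    using NM MN by blast
  then have "matrix_inv M ** M = mat 1"
    unfolding matrix_inv_def by (rule someI2_ex) simp
  then have "matrix_inv M = N"
    using MN by (metis matrix_mul_assoc matrix_mul_lid matrix_mul_rid)
  then show ?thesis by (simp add: N_def)
qed

lemma slow_dscale': "slow (dscale' r Y K) = slow K" and slow_dscale: "slow (dscale r Y) = slow Y"
  by (auto simp: slow_def dscale'_def dscale_def vec_eq_iff)

text \<open>In the chart the Cholesky map is simply \<open>dscale r\<close>, so its differential is
  \<open>dscale' r y\<close>, by \<open>dir_deriv_chart\<close>.\<close>

lemma pullback_chart_map:
  fixes y :: "'n::{finite,linorder} sqmat"
  assumes r: "r \<noteq> 0" and y: "y \<in> lower_pp" and k: "k \<in> lower" and h: "h \<in> lower"
  shows "pullback_metric chol g (chart_map r y) (chart_map' r y k) (chart_map' r y h)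
    = g (dscale r y) (dscale' r y k) (dscale' r y h)"
proof -
  interpret subspace_chart sym_mats "lower :: 'n sqmat set" lower_pp "chart_map r" "chart_map' r" "chart_map'' r"
    by (rule subspace_chart_chol[OF r])
  have c: "chol (chart_map r z) = dscale r z" if "z \<in> lower_pp" for z :: "'n sqmat"
    unfolding chart_map_def by (rule chol_unique[OF dscale_in[OF that]])
  have "dir_deriv chol (chart_map r y) (chart_map' r y k) = dscale' r y k" if "k \<in> lower" for k
    by (rule dir_deriv_chart[OF c y that dscale_deriv[OF y]])
  then show ?thesis
    using c[OF y] k h by (simp add: pullback_metric_def)
qed

lemma pcm_chart_map:
  fixes y :: "'n::{finite,linorder} sqmat"
  assumes \<theta>: "\<theta> \<noteq> 0" and y: "y \<in> lower_pp" and k: "k \<in> lower" and h: "h \<in> lower"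
  shows "pcm \<theta> (chart_map (1 / \<theta>) y) (chart_map' (1 / \<theta>) y k) (chart_map' (1 / \<theta>) y h)
    = flat_form (\<lambda>i. 1 / \<theta>\<^sup>2) k h"
proof -
  let ?r = "1 / \<theta>"
  have e: "dscale ?r y $ i $ i powr (\<theta> - 1) * dscale' ?r y k $ i $ i = k $ i $ i / \<theta>" for i and k :: "'n sqmat"
  proof -
    \<comment> \<open>This determines the exponent: with \<open>r = 1 / \<theta>\<close> the power
      in the metric cancels the one from the derivative, leaving the factor
      \<open>1 / \<theta>\<close> on each vector.\<close>
    have "?r * (\<theta> - 1) + (?r - 1) = 0" using \<theta> by (simp add: field_simps)
    then have "y $ i $ i powr (?r * (\<theta> - 1)) * y $ i $ i powr (?r - 1) = 1"
      using lower_ppD(2)[OF y, of i] by (simp flip: powr_add)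
    then show ?thesis
      by (simp add: dscale_def dscale'_def powr_powr)
  qed
  have "pcm \<theta> (chart_map ?r y) (chart_map' ?r y k) (chart_map' ?r y h)
    = pcm_chol \<theta> (dscale ?r y) (dscale' ?r y k) (dscale' ?r y h)"
    unfolding pcm_def using \<theta> by (intro pullback_chart_map y k h) simp
  also have "\<dots> = flat_form (\<lambda>i. 1 / \<theta>\<^sup>2) k h"
    unfolding pcm_chol_def dpow_dg dg_diag_mat[of "dscale' _ _ _"] diag_mat_mult inner_diag_mat e
    by (simp add: slow_dscale' flat_form_def power2_eq_square)
  finally show ?thesis .
qed

lemma bwcm_chart_map:
  fixes y :: "'n::{finite,linorder} sqmat"
  assumes \<theta>: "\<theta> \<noteq> 0" and M: "M \<in> diag_pp" and y: "y \<in> lower_pp" and k: "k \<in> lower" and h: "h \<in> lower"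
  shows "bwcm \<theta> M (chart_map (2 / \<theta>) y) (chart_map' (2 / \<theta>) y k) (chart_map' (2 / \<theta>) y h)
    = flat_form (\<lambda>i. 1 / (\<theta>\<^sup>2 * M $ i $ i)) k h"
proof -
  let ?r = "2 / \<theta>"
  \<comment> \<open>The power weights only the first vector and \<open>matrix_inv M\<close> only the
    second, so the powers cancel only in the product of both. The factor \<open>4\<close>
    compensates the \<open>1/4\<close> in \<open>bwcm_chol\<close>.\<close>
  have e: "dscale ?r y $ i $ i powr (\<theta> - 2) * dscale' ?r y k $ i $ i * (1 / M $ i $ i * dscale' ?r y h $ i $ i)
    = 4 * (1 / (\<theta>\<^sup>2 * M $ i $ i) * (k $ i $ i * h $ i $ i))" for i
  proof -
    have "?r * (\<theta> - 2) + (?r - 1) + (?r - 1) = 0" using \<theta> by (simp add: field_simps)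
    then have *: "y $ i $ i powr (?r * (\<theta> - 2)) * y $ i $ i powr (?r - 1) * y $ i $ i powr (?r - 1) = 1"
      using lower_ppD(2)[OF y, of i] by (simp flip: powr_add)
    have "dscale ?r y $ i $ i powr (\<theta> - 2) * dscale' ?r y k $ i $ i * (1 / M $ i $ i * dscale' ?r y h $ i $ i)
      = (y $ i $ i powr (?r * (\<theta> - 2)) * y $ i $ i powr (?r - 1) * y $ i $ i powr (?r - 1))
        * (?r * ?r * (1 / M $ i $ i) * (k $ i $ i * h $ i $ i))"
      by (simp add: dscale_def dscale'_def powr_powr divide_inverse ac_simps)
    then show ?thesis unfolding * by (simp add: power2_eq_square)
  qed
  have "bwcm \<theta> M (chart_map ?r y) (chart_map' ?r y k) (chart_map' ?r y h)
    = bwcm_chol \<theta> M (dscale ?r y) (dscale' ?r y k) (dscale' ?r y h)"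
    unfolding bwcm_def using \<theta> by (intro pullback_chart_map y k h) simp
  also have "\<dots> = flat_form (\<lambda>i. 1 / (\<theta>\<^sup>2 * M $ i $ i)) k h"
    unfolding bwcm_chol_def dpow_dg matrix_inv_diag_pp[OF M] dg_diag_mat[of "dscale' _ _ _"] diag_mat_mult inner_diag_mat e
      sum_distrib_left[symmetric]
    by (simp add: slow_dscale' flat_form_def)
  finally show ?thesis .
qed

section \<open>The logistic regressions\<close>

lemma softmax_cong:
  assumes "\<And>j. j \<in> {1..C} \<Longrightarrow> s j = s' j" and "k \<in> {1..C}"
  shows "softmax C s k = softmax C s' k"
  using assms by (simp add: softmax_def)

text \<open>Both regressions are instances, with different \<open>r\<close> and \<open>w\<close>.
  The point \<open>L ** transpose L\<close> has coordinates \<open>dscale (1 / r) L\<close>, which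
  is where the powers of the diagonals come from.\<close>

lemma spd_mlr_flat:
  fixes K S :: "'n::{finite,linorder} sqmat" and P L A :: "nat \<Rightarrow> 'n sqmat"
  assumes r: "r \<noteq> 0" and w: "\<And>i. w i > 0"
    and g: "\<And>y k h. y \<in> lower_pp \<Longrightarrow> k \<in> lower \<Longrightarrow> h \<in> lower \<Longrightarrow>
      g (chart_map r y) (chart_map' r y k) (chart_map' r y h) = flat_form w k h"
    and A: "\<And>k. k \<in> {1..C} \<Longrightarrow> A k \<in> lower"
    and K: "K \<in> lower_pp" "S = K ** transpose K"
    and L: "\<And>k. k \<in> {1..C} \<Longrightarrow> L k \<in> lower_pp" "\<And>k. k \<in> {1..C} \<Longrightarrow> P k = L k ** transpose (L k)"
    and k: "k \<in> {1..C}"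
  shows "spd_mlr g C P A S k = softmax C (\<lambda>k. (slow K - slow (L k)) \<bullet> slow (A k)
    + (\<Sum>i\<in>UNIV. w i * ((K $ i $ i powr (1 / r) - L k $ i $ i powr (1 / r)) * (A k $ i $ i / (2 * r))))) k"
proof -
  have convex: "convex (lower_pp :: 'n sqmat set)"
    unfolding convex_def
  proof (intro ballI allI impI)
    fix X Y :: "'n sqmat" and u v :: real
    assume XY: "X \<in> lower_pp" "Y \<in> lower_pp" and uv: "0 \<le> u" "0 \<le> v" "u + v = 1"
    have "0 < u * X $ i $ i + v * Y $ i $ i" for i
      using XY[THEN lower_ppD(2), of i] uv by (cases "u = 0") (auto intro: add_pos_nonneg)
    then show "u *\<^sub>R X + v *\<^sub>R Y \<in> lower_pp"
      using XY by (simp add: lower_pp_def lower_def)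
  qed
  interpret subspace_chart sym_mats "lower :: 'n sqmat set" lower_pp "chart_map r" "chart_map' r" "chart_map'' r"
    by (rule subspace_chart_chol[OF r])
  interpret flat_chart sym_mats "lower :: 'n sqmat set" lower_pp "chart_map r" "chart_map' r" "chart_map'' r"
      "flat_form w" g
    by (intro flat_chart.intro flat_chart_axioms.intro subspace_chart_axioms convex
        bounded_bilinear_flat_form flat_form_commute flat_form_pos w g)
  have U: "U = spd"
    unfolding U_def by (rule chart_map_image[OF r])
  have G: "chart_map r (dscale (1 / r) X) = X ** transpose X" if "X \<in> lower_pp" for X :: "'n sqmat"
    using dscale_dscale[OF that, of r "1 / r"] r by (simp add: chart_map_def)
  have one: "dscale s (mat 1) = (mat 1 :: 'n sqmat)" for s
    by (simp add: dscale_def mat_def vec_eq_iff)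
  have I: "chart_map r (mat 1) = (mat 1 :: 'n sqmat)"
    by (simp add: chart_map_def one transpose_mat)
  \<comment> \<open>\<open>H A\<close> gives the coordinates of \<open>sym_of_lower A\<close> at the
    identity. There the chart differential sends \<open>Y\<close> to
    \<open>dscale' r (mat 1) Y\<close> plus its transpose, which multiplies the diagonal by
    \<open>2 * r\<close>.\<close>
  define H where "H = (\<lambda>A::'n sqmat. \<chi> i j. if i = j then A $ i $ i / (2 * r) else A $ i $ j)"
  have H: "H A \<in> lower" "slow (H A) = slow A" "H A $ i $ i = A $ i $ i / (2 * r)"
    "chart_map' r (mat 1) (H A) = sym_of_lower A" if A: "A \<in> lower" for A :: "'n sqmat" and i
  proof -
    show "H A \<in> lower" "slow (H A) = slow A" "H A $ i $ i = A $ i $ i / (2 * r)"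
      using A by (auto simp: H_def lower_def slow_def vec_eq_iff)
    have "(H' + transpose H') $ i $ j = sym_of_lower A $ i $ j" if "H' = dscale' r (mat 1) (H A)" for i j H'
      using A r that by (cases i j rule: linorder_cases)
        (auto simp: sym_of_lower_def transpose_def dscale'_def H_def lower_def mat_def)
    then show "chart_map' r (mat 1) (H A) = sym_of_lower A"
      by (simp add: chart_map'_def one sprod_mat_1 vec_eq_iff)
  qed
  have "sgn (g (P k) (par_transport sym_mats spd g (mat 1) (P k) (sym_of_lower (A k)))
          (riem_log sym_mats spd g (P k) S))
      * riem_norm g (P k) (par_transport sym_mats spd g (mat 1) (P k) (sym_of_lower (A k)))
      * margin_dist sym_mats spd g (par_transport sym_mats spd g (mat 1) (P k) (sym_of_lower (A k))) (P k) S
    = (slow K - slow (L k)) \<bullet> slow (A k)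
      + (\<Sum>i\<in>UNIV. w i * ((K $ i $ i powr (1 / r) - L k $ i $ i powr (1 / r)) * (A k $ i $ i / (2 * r))))"
    if k: "k \<in> {1..C}" for k
  proof -
    note Lk = L(1)[OF k] and Ak = A[OF k]
    have "flat_form w (dscale (1 / r) K - dscale (1 / r) (L k)) (H (A k))
      = (slow K - slow (L k)) \<bullet> slow (A k)
        + (\<Sum>i\<in>UNIV. w i * ((K $ i $ i powr (1 / r) - L k $ i $ i powr (1 / r)) * (A k $ i $ i / (2 * r))))"
      unfolding flat_form_def slow_diff slow_dscale H(2,3)[OF Ak] by (simp add: dscale_def)
    with mlr_score[OF dscale_in[OF Lk] dscale_in[OF K(1)] mat_1_lower_pp H(1)[OF Ak], of "1 / r" "1 / r"]
    show ?thesis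
      unfolding U G[OF Lk] G[OF K(1)] I H(4)[OF Ak] K(2) L(2)[OF k] by simp
  qed
  then show ?thesis
    unfolding spd_mlr_def riem_mlr_def by (intro softmax_cong k)
qed

theorem theorem5p1:
  fixes \<theta> :: real and C :: nat
    and M S K :: "'n::{finite,linorder} sqmat"
    and P A L :: "nat \<Rightarrow> 'n sqmat"
  assumes "\<theta> \<noteq> 0" and "M \<in> diag_pp" and "1 \<le> C"
    and "\<And>k. k \<in> {1..C} \<Longrightarrow> P k \<in> spd"
    and "\<And>k. k \<in> {1..C} \<Longrightarrow> A k \<in> lower"
    and "S \<in> spd"
    and "K \<in> lower_pp" and "S = K ** transpose K"
    and "\<And>k. k \<in> {1..C} \<Longrightarrow> L k \<in> lower_pp"
    and "\<And>k. k \<in> {1..C} \<Longrightarrow> P k = L k ** transpose (L k)"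
  shows "(\<forall>k\<in>{1..C}. spd_mlr (pcm \<theta>) C P A S k =
            softmax C (\<lambda>k. (slow K - slow (L k)) \<bullet> slow (A k)
              + 1 / (2 * \<theta>) * ((dpow (dg K) \<theta> - dpow (dg (L k)) \<theta>) \<bullet> dg (A k))) k)
       \<and> (\<forall>k\<in>{1..C}. spd_mlr (bwcm \<theta> M) C P A S k =
            softmax C (\<lambda>k. (slow K - slow (L k)) \<bullet> slow (A k)
              + 1 / (4 * \<theta>) * ((dpow (dg K) (\<theta> / 2) - dpow (dg (L k)) (\<theta> / 2))
                  \<bullet> (matrix_inv M ** dg (A k)))) k)"
proof (intro conjI ballI)
  fix k assume k: "k \<in> {1..C}"
  have pos: "0 < M $ i $ i" for i
    using assms(2) by (simp add: diag_pp_def)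
  then have nz: "M $ i $ i \<noteq> 0" for i
    by (metis less_irrefl)
  \<comment> \<open>The weight \<open>1 / \<theta>\<^sup>2\<close> times the factor
    \<open>\<theta> / 2\<close> from \<open>1 / (2 * r)\<close> gives
    \<open>1 / (2 * \<theta>)\<close>.\<close>
  have "1 / (2 * \<theta>) * ((dpow (dg K) \<theta> - dpow (dg (L k)) \<theta>) \<bullet> dg (A k))
    = (\<Sum>i\<in>UNIV. 1 / \<theta>\<^sup>2 * ((K $ i $ i powr (1 / (1 / \<theta>)) - L k $ i $ i powr (1 / (1 / \<theta>)))
        * (A k $ i $ i / (2 * (1 / \<theta>)))))" for k
    unfolding dpow_dg dg_diag_mat[of "A _"] diag_mat_diff inner_diag_mat sum_distrib_left
    by (rule sum.cong) (use assms(1) in \<open>simp_all add: power2_eq_square field_simps\<close>)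
  then show "spd_mlr (pcm \<theta>) C P A S k = softmax C (\<lambda>k. (slow K - slow (L k)) \<bullet> slow (A k)
      + 1 / (2 * \<theta>) * ((dpow (dg K) \<theta> - dpow (dg (L k)) \<theta>) \<bullet> dg (A k))) k"
    using spd_mlr_flat[OF _ _ pcm_chart_map[OF assms(1)] assms(5,7-10) k] assms(1) by simp
  \<comment> \<open>Now \<open>r = 2 / \<theta>\<close>, so \<open>1 / (2 * r)\<close> is
    \<open>\<theta> / 4\<close>, and the weight contributes the entries of
    \<open>matrix_inv M\<close>.\<close>
  have "1 / (4 * \<theta>) * ((dpow (dg K) (\<theta> / 2) - dpow (dg (L k)) (\<theta> / 2)) \<bullet> (matrix_inv M ** dg (A k)))
    = (\<Sum>i\<in>UNIV. 1 / (\<theta>\<^sup>2 * M $ i $ i) * ((K $ i $ i powr (1 / (2 / \<theta>)) - L k $ i $ i powr (1 / (2 / \<theta>)))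
        * (A k $ i $ i / (2 * (2 / \<theta>)))))" for k
    unfolding dpow_dg matrix_inv_diag_pp[OF assms(2)] dg_diag_mat[of "A _"] diag_mat_diff diag_mat_mult inner_diag_mat sum_distrib_left
    by (rule sum.cong) (use assms(1) nz in \<open>simp_all add: power2_eq_square field_simps\<close>)
  then show "spd_mlr (bwcm \<theta> M) C P A S k = softmax C (\<lambda>k. (slow K - slow (L k)) \<bullet> slow (A k)
      + 1 / (4 * \<theta>) * ((dpow (dg K) (\<theta> / 2) - dpow (dg (L k)) (\<theta> / 2))
          \<bullet> (matrix_inv M ** dg (A k)))) k"
    using spd_mlr_flat[OF _ _ bwcm_chart_map[OF assms(1,2)] assms(5,7-10) k] assms(1) pos by simp
qed

end
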